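(* Let $p$ be an odd prime, $K/\mathbb Q_p$ a finite extension, and $\xi=\sum_za_z[z]_{\mathrm{cyc}}$ a finite cyclotomic presentation with coefficients $a_z\in K$, supported on roots of unity $z\in K$, $z\neq1$, of order prime to $p$. For any two odd integers $c,d>1$ prime to $p$, $$r_d\star N_{\xi,c}=r_c\star N_{\xi,d}\qquad\text{in }\Lambda_K(G).$$
   Context: $G=\mathbb Z_p^\times$, $\mathcal O$ is the valuation ring of $K$, and $\Lambda_K(G)=\mathcal O[[G]][1/p]$ is the algebra of bounded $K$-valued measures on $G$ under multiplicative convolution $(D_1\star D_2)(f)=(D_1\otimes D_2)((x,y)\mapsto f(xy))$. $\delta_u$ is the Dirac measure at $u$ and $r_c=\delta_1-c\,\delta_c$. $\lambda_{1/2,c}$ is the bounded $\mathcal O$-valued measure on $\mathbb Z_p$ with Amice transform $\int_{\mathbb Z_p}(1+T)^x\,d\lambda_{1/2,c}(x)=\frac{(1+T)^{1/2}}T-c\frac{(1+T)^{c/2}}{(1+T)^c-1}\in\mathcal O[[T]]$, and $\lambda^\times_{1/2,c}$ is its restriction to $G$. For a root of unity $z\ne1$ of order prime to $p$, $\mu_z$ is the bounded measure on $\mathbb Z_p$ with $\mu_z(a+p^m\mathbb Z_p)=z^a/(1-z^{p^m})$ for $0\le a<p^m$; $\nu_z^\times=x^{-1}\mathbf 1_G\mu_z$ and $\nu_\xi^\times=\sum_za_z\nu_z^\times$. Finally $N_{\xi,c}=\lambda^\times_{1/2,c}\star\nu^\times_\xi\in\Lambda_K(G)$. *)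

theory Defs
  imports
    "HOL-Analysis.Analysis"
    "HOL-Library.Poly_Mapping"
    "HOL-Computational_Algebra.Formal_Laurent_Series"
begin

text \<open>
  The field \<open>K\<close> is the type \<open>'a\<close>; its absolute value is \<open>\<lambda>x. dist x 0\<close>, normalised by
  \<open>\<bar>p\<bar> = 1/p\<close>.  Since \<open>K\<close> is complete and its absolute value restricts to the \<open>p\<close>-adic one on
  \<open>\<rat>\<close>, the closures of \<open>\<rat>\<close> and \<open>\<int>\<close> in \<open>K\<close> are the copies of \<open>\<rat>\<^sub>p\<close> and \<open>\<int>\<^sub>p\<close> inside \<open>K\<close>.
\<close>

abbreviation (input) absval :: "'a :: {field_char_0, metric_space} \<Rightarrow> real" where
  "absval x \<equiv> dist x 0"

definition Qp :: "'a :: {field_char_0, metric_space} set" where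
  "Qp = closure \<rat>"

definition Zp :: "'a :: {field_char_0, metric_space} set" where
  "Zp = closure \<int>"

definition Zp_units :: "'a :: {field_char_0, metric_space} set" where
  "Zp_units = {x \<in> Zp. \<exists>y\<in>Zp. x * y = 1}"

definition valuation_ring :: "'a :: {field_char_0, metric_space} set" where
  "valuation_ring = {x. absval x \<le> 1}"

definition finite_ext_of_Qp :: "nat \<Rightarrow> 'a :: {field_char_0, complete_space} itself \<Rightarrow> bool" where
  "finite_ext_of_Qp p K \<longleftrightarrow>
     prime p \<and>
     (\<forall>x y :: 'a. dist x y = absval (x - y)) \<and>
     (\<forall>x y :: 'a. absval (x * y) = absval x * absval y) \<and>
     (\<forall>x y :: 'a. absval (x + y) \<le> max (absval x) (absval y)) \<and>
     absval (of_nat p :: 'a) = 1 / real p \<and>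
     (\<exists>B :: 'a set. finite B \<and>
        (\<forall>x. \<exists>q. (\<forall>b\<in>B. q b \<in> Qp) \<and> x = (\<Sum>b\<in>B. q b * b)))"


text \<open>
  Bounded \<open>K\<close>-valued measures on \<open>X \<subseteq> K\<close>: bounded \<open>K\<close>-linear functionals on the continuous
  functions \<open>X \<rightarrow> K\<close>.  A functional takes the value \<open>0\<close> on functions which are not continuous
  on \<open>X\<close>, and boundedness (with \<open>B = 0\<close>) makes it independent of the values off \<open>X\<close>, so that
  equality of measures is equality in HOL.
\<close>

definition bounded_measures ::
    "'a :: {field_char_0, metric_space} set \<Rightarrow> (('a \<Rightarrow> 'a) \<Rightarrow> 'a) set" where
  "bounded_measures X = {D.
     (\<forall>f. \<not> continuous_on X f \<longrightarrow> D f = 0) \<and>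
     (\<forall>f g. continuous_on X f \<longrightarrow> continuous_on X g \<longrightarrow> D (\<lambda>x. f x + g x) = D f + D g) \<and>
     (\<forall>k f. continuous_on X f \<longrightarrow> D (\<lambda>x. k * f x) = k * D f) \<and>
     (\<exists>C. \<forall>f B. continuous_on X f \<longrightarrow> (\<forall>x\<in>X. absval (f x) \<le> B) \<longrightarrow> absval (D f) \<le> C * B)}"

abbreviation Lambda_G :: "(('a :: {field_char_0, metric_space} \<Rightarrow> 'a) \<Rightarrow> 'a) set" where
  "Lambda_G \<equiv> bounded_measures Zp_units"

definition integral_valued ::
    "'a :: {field_char_0, metric_space} set \<Rightarrow> (('a \<Rightarrow> 'a) \<Rightarrow> 'a) \<Rightarrow> bool" where
  "integral_valued X D \<longleftrightarrow>
     (\<forall>f. continuous_on X f \<longrightarrow> f ` X \<subseteq> valuation_ring \<longrightarrow> D f \<in> valuation_ring)"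

text \<open>The product measure, given by iterated integration.\<close>

definition tensor_measure ::
    "'a :: {field_char_0, metric_space} set \<Rightarrow> 'a set \<Rightarrow>
     (('a \<Rightarrow> 'a) \<Rightarrow> 'a) \<Rightarrow> (('a \<Rightarrow> 'a) \<Rightarrow> 'a) \<Rightarrow> ('a \<times> 'a \<Rightarrow> 'a) \<Rightarrow> 'a" where
  "tensor_measure X Y D1 D2 =
     (\<lambda>h. if continuous_on (X \<times> Y) h then D1 (\<lambda>x. D2 (\<lambda>y. h (x, y))) else 0)"

definition mult_conv ::
    "(('a :: {field_char_0, metric_space} \<Rightarrow> 'a) \<Rightarrow> 'a) \<Rightarrow> (('a \<Rightarrow> 'a) \<Rightarrow> 'a) \<Rightarrow> ('a \<Rightarrow> 'a) \<Rightarrow> 'a"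
    (infixl \<open>\<star>\<close> 70) where
  "D1 \<star> D2 =
     (\<lambda>f. if continuous_on Zp_units f
          then tensor_measure Zp_units Zp_units D1 D2 (\<lambda>(x, y). f (x * y)) else 0)"

definition dirac :: "'a :: {field_char_0, metric_space} \<Rightarrow> ('a \<Rightarrow> 'a) \<Rightarrow> 'a" where
  "dirac u = (\<lambda>f. if continuous_on Zp_units f then f u else 0)"

definition r_meas :: "nat \<Rightarrow> ('a :: {field_char_0, metric_space} \<Rightarrow> 'a) \<Rightarrow> 'a" where
  "r_meas c = (\<lambda>f. dirac 1 f - of_nat c * dirac (of_nat c) f)"

text \<open>
  The restriction to \<open>Zp_units\<close> of \<open>g\<close> times a measure on \<open>Zp\<close>: integration of
  \<open>g * f\<close>, extended by zero to \<open>Zp\<close>.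
\<close>

definition restrict_units ::
    "('a :: {field_char_0, metric_space} \<Rightarrow> 'a) \<Rightarrow> (('a \<Rightarrow> 'a) \<Rightarrow> 'a) \<Rightarrow> ('a \<Rightarrow> 'a) \<Rightarrow> 'a" where
  "restrict_units g D =
     (\<lambda>f. if continuous_on Zp_units f
          then D (\<lambda>x. if x \<in> Zp_units then g x * f x else 0) else 0)"


text \<open>\<open>fps_binomial x\<close> is the binomial series \<open>(1 + T)\<^sup>x\<close>; the integral is taken coefficientwise.\<close>

definition amice_transform :: "(('a :: {field_char_0, metric_space} \<Rightarrow> 'a) \<Rightarrow> 'a) \<Rightarrow> 'a fps" where
  "amice_transform D = Abs_fps (\<lambda>n. D (\<lambda>x. fps_nth (fps_binomial x) n))"

text \<open>The two summands have a pole at \<open>T = 0\<close>, hence the Laurent series.\<close>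

definition lambda_half :: "nat \<Rightarrow> ('a :: {field_char_0, metric_space} \<Rightarrow> 'a) \<Rightarrow> 'a" where
  "lambda_half c = (THE D. D \<in> bounded_measures Zp \<and> integral_valued Zp D \<and>
     fps_to_fls (amice_transform D) =
       fps_to_fls (fps_binomial (1 / 2)) / fls_X
       - of_nat c * (fps_to_fls (fps_binomial (of_nat c / 2)) / ((1 + fls_X) ^ c - 1)))"

definition lambda_half_units :: "nat \<Rightarrow> ('a :: {field_char_0, metric_space} \<Rightarrow> 'a) \<Rightarrow> 'a" where
  "lambda_half_units c = restrict_units (\<lambda>_. 1) (lambda_half c)"


definition root_of_unity :: "'a :: field \<Rightarrow> bool" where
  "root_of_unity z \<longleftrightarrow> (\<exists>n>0. z ^ n = 1)"

definition root_order :: "'a :: field \<Rightarrow> nat" where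
  "root_order z = (LEAST n. n > 0 \<and> z ^ n = 1)"

definition mu_meas :: "nat \<Rightarrow> 'a :: {field_char_0, metric_space} \<Rightarrow> ('a \<Rightarrow> 'a) \<Rightarrow> 'a" where
  "mu_meas p z = (THE D. D \<in> bounded_measures Zp \<and>
     (\<forall>m. \<forall>a<p ^ m. D (indicator ((\<lambda>y. of_nat a + of_nat p ^ m * y) ` Zp))
                      = z ^ a / (1 - z ^ (p ^ m))))"

definition nu_meas :: "nat \<Rightarrow> 'a :: {field_char_0, metric_space} \<Rightarrow> ('a \<Rightarrow> 'a) \<Rightarrow> 'a" where
  "nu_meas p z = restrict_units inverse (mu_meas p z)"

text \<open>
  A finite cyclotomic presentation \<open>\<Sum>\<^sub>z a\<^sub>z [z]\<close> is the finitely supported function \<open>z \<mapsto> a\<^sub>z\<close>.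
\<close>

definition cyclotomic_presentation ::
    "nat \<Rightarrow> ('a :: {field_char_0, metric_space} \<Rightarrow>\<^sub>0 'a) \<Rightarrow> bool" where
  "cyclotomic_presentation p \<xi> \<longleftrightarrow>
     (\<forall>z\<in>Poly_Mapping.keys \<xi>. root_of_unity z \<and> z \<noteq> 1 \<and> coprime (root_order z) p)"

definition nu_pres ::
    "nat \<Rightarrow> ('a :: {field_char_0, metric_space} \<Rightarrow>\<^sub>0 'a) \<Rightarrow> ('a \<Rightarrow> 'a) \<Rightarrow> 'a" where
  "nu_pres p \<xi> = (\<lambda>f. \<Sum>z\<in>Poly_Mapping.keys \<xi>. Poly_Mapping.lookup \<xi> z * nu_meas p z f)"

definition N_meas ::
    "nat \<Rightarrow> ('a :: {field_char_0, metric_space} \<Rightarrow>\<^sub>0 'a) \<Rightarrow> nat \<Rightarrow> ('a \<Rightarrow> 'a) \<Rightarrow> 'a" where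
  "N_meas p \<xi> c = lambda_half_units c \<star> nu_pres p \<xi>"

end

theory Submission
  imports Defs
begin

text \<open>
  Why the two sides agree. Write \<open>\<nu>\<close> for the measure attached to the cyclotomic presentation.
  Evaluated on a continuous function \<open>f\<close> on the units, the left-hand side is
  \<open>\<lambda>\<^sub>c(F) - d \<lambda>\<^sub>c(x \<mapsto> F(d x))\<close>, where \<open>F(x) = \<nu>(y \<mapsto> f(x y))\<close> is again continuous
  (\<open>r_meas_conv_apply\<close>). So \<open>\<nu>\<close> enters only through \<open>F\<close>, and the claim is that the measures
  \<open>\<lambda>\<^sub>c - d [d]\<^sub>*\<lambda>\<^sub>c\<close> and \<open>\<lambda>\<^sub>d - c [c]\<^sub>*\<lambda>\<^sub>d\<close> coincide, where \<open>[n]\<^sub>*\<close> is the push-forward along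
  \<open>x \<mapsto> n x\<close>. As multiplication by \<open>d\<close> preserves both the units and their complement, it is enough
  to prove this on all of the p-adic integers.

  There it is visible on Amice transforms. Pushing forward along \<open>x \<mapsto> n x\<close> substitutes
  \<open>(1 + T)\<^sup>n - 1\<close> for \<open>T\<close> (\<open>amice_transform_dilate\<close>). If \<open>B(T) = (1 + T)\<^sup>1\<^sup>/\<^sup>2 / T\<close> and \<open>B\<^sub>n\<close> is the
  result of this substitution in \<open>B\<close>, then \<open>\<lambda>\<^sub>c\<close> has transform \<open>B - c B\<^sub>c\<close>, and therefore
  \<open>\<lambda>\<^sub>c - d [d]\<^sub>*\<lambda>\<^sub>c\<close> has transform \<open>B - c B\<^sub>c - d B\<^sub>d + c d B\<^sub>c\<^sub>d\<close>, which is symmetric in \<open>c\<close> and \<open>d\<close>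
  (\<open>half_transform_symmetry\<close>).

  This needs that a bounded measure is determined by its Amice transform, and that measures with the
  required transforms exist at all, since \<open>\<lambda>\<^sub>c\<close> and \<open>\<mu>\<^sub>z\<close> are introduced by definite descriptions. Both
  facts about Amice transforms follow from Mahler's theorem (\<open>mahler_expansion\<close>), whose core is that
  the iterated differences \<open>\<Delta>\<^sup>n f(0)\<close> of a continuous function tend to \<open>0\<close>. The measures \<open>\<mu>\<^sub>z\<close> are limits
  of Riemann sums (\<open>root_of_unity_measure_exists\<close>).
\<close>

section \<open>Complete ultrametric fields\<close>

text \<open>
  The instance of the type class provides only a metric; that this metric comes from an absolute
  value, and that the field operations are continuous for it, has to be derived from these
  assumptions. The dummy parameter \<open>K\<close> pins down the type of the field.
\<close>

locale padic_field =
  fixes p :: nat and K :: "'a :: {field_char_0, complete_space} itself"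
  assumes prime_p: "prime p"
    and dist_absval: "\<And>x y :: 'a. dist x y = absval (x - y)"
    and absval_mult: "\<And>x y :: 'a. absval (x * y) = absval x * absval y"
    and absval_add_le_max: "\<And>x y :: 'a. absval (x + y) \<le> max (absval x) (absval y)"
    and absval_p: "absval (of_nat p :: 'a) = 1 / real p"
begin

lemma p_gt_1: "1 < p" and p_pos: "0 < p"
  using prime_p prime_gt_1_nat prime_gt_0_nat by blast+

lemma absval_1 [simp]: "absval (1 :: 'a) = 1"
  using absval_mult[of 1 1] by (metis dist_eq_0_iff mult_cancel_left1 mult_1 zero_neq_one)

lemma absval_minus [simp]: "absval (- x) = absval x" for x :: 'a
  by (metis diff_0 dist_absval dist_commute)

lemma absval_triangle: "absval (x + y) \<le> absval x + absval y" for x y :: 'a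
  using absval_add_le_max[of x y] zero_le_dist[of x 0] zero_le_dist[of y 0] by linarith

lemma absval_diff_le_max: "absval (x - y) \<le> max (absval x) (absval y)" for x y :: 'a
  using absval_add_le_max[of x "- y"] by simp

lemma absval_add_le: "absval x \<le> B \<Longrightarrow> absval y \<le> B \<Longrightarrow> absval (x + y) \<le> B" for x y :: 'a
  using absval_add_le_max[of x y] by linarith

lemma absval_diff_le: "absval x \<le> B \<Longrightarrow> absval y \<le> B \<Longrightarrow> absval (x - y) \<le> B" for x y :: 'a
  using absval_diff_le_max[of x y] by linarith

lemma absval_sum_le:
  fixes f :: "'i \<Rightarrow> 'a"
  assumes "\<And>i. i \<in> A \<Longrightarrow> absval (f i) \<le> B" and "0 \<le> B"
  shows "absval (sum f A) \<le> B"
  using assms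
proof (induction A rule: infinite_finite_induct)
  case (insert i A)
  then show ?case by (simp add: absval_add_le)
qed auto

lemma absval_mult_le:
  fixes x y :: 'a
  shows "absval x \<le> 1 \<Longrightarrow> absval y \<le> B \<Longrightarrow> absval (x * y) \<le> B"
  by (metis absval_mult mult_left_le_one_le order_trans zero_le_dist)

lemma absval_power: "absval (x ^ n) = absval x ^ n" for x :: 'a
  by (induction n) (auto simp: absval_mult)

lemma absval_inverse: "absval (inverse x) = inverse (absval x)" for x :: 'a
proof (cases "x = 0")
  case False
  then show ?thesis
    using absval_mult[of x "inverse x"] by (simp add: inverse_unique)
qed simp

lemma absval_divide: "absval (x / y) = absval x / absval y" for x y :: 'a
  by (simp add: divide_inverse absval_mult absval_inverse)

lemma absval_p_power: "absval (of_nat p ^ m :: 'a) = 1 / real p ^ m"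
  by (simp add: absval_power absval_p power_one_over)

lemma absval_of_nat_le_1: "absval (of_nat n :: 'a) \<le> 1"
  by (induction n) (auto intro!: absval_add_le)

lemma absval_of_int_le_1: "absval (of_int n :: 'a) \<le> 1"
  by (cases n rule: int_cases2) (auto simp: absval_of_nat_le_1)

lemma inverse_p_less_1: "1 / real p < 1"
  using p_gt_1 by simp

text \<open>
  A Bezout relation \<open>u n + v p = 1\<close> forces \<open>\<bar>u n\<bar> = 1\<close>, because \<open>\<bar>v p\<bar> < 1\<close>.
\<close>

lemma absval_of_int_coprime:
  assumes "coprime n (int p)"
  shows "absval (of_int n :: 'a) = 1"
proof -
  obtain u v where uv: "u * n + v * int p = 1"
    using assms by (metis bezout_int coprime_iff_gcd_eq_1)
  have "absval (of_int v * of_nat p :: 'a) < 1"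
    using absval_mult_le[OF absval_of_int_le_1, of "of_nat p" "1 / real p" v] absval_p
      inverse_p_less_1 by simp
  moreover have "(1 :: 'a) = of_int u * of_int n + of_int v * of_nat p"
    using uv by (metis of_int_1 of_int_add of_int_mult of_int_of_nat_eq)
  then have "1 \<le> max (absval (of_int u * of_int n :: 'a)) (absval (of_int v * of_nat p :: 'a))"
    by (metis absval_1 absval_add_le_max)
  ultimately have "1 \<le> absval (of_int u * of_int n :: 'a)"
    by linarith
  then have "1 \<le> absval (of_int n :: 'a)"
    using absval_mult_le[OF absval_of_int_le_1 order_refl, of u "of_int n"] by linarith
  then show ?thesis
    using absval_of_int_le_1[of n] by linarith
qed

lemma absval_of_nat_coprime: "coprime n p \<Longrightarrow> absval (of_nat n :: 'a) = 1"
  using absval_of_int_coprime[of "int n"] by simp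

text \<open>
  Together with its converse below, this identifies the absolute value on the integers with the
  p-adic one.
\<close>

lemma p_power_dvd_if_absval_le:
  "absval (of_int n :: 'a) \<le> 1 / real p ^ m \<Longrightarrow> int p ^ m dvd n"
proof (induction m)
  case (Suc m)
  have "absval (of_int n :: 'a) \<le> 1 / real p ^ m"
    using Suc.prems p_gt_1 by (elim order_trans) (simp add: field_simps)
  then obtain k where k: "n = int p ^ m * k"
    using Suc.IH by blast
  have "absval (of_int k :: 'a) / real p ^ m \<le> (1 / real p) / real p ^ m"
    using Suc.prems k by (simp add: absval_mult absval_p_power field_simps)
  then have "absval (of_int k :: 'a) \<le> 1 / real p"
    using p_pos by (subst (asm) divide_le_cancel) auto
  then have "absval (of_int k :: 'a) < 1"
    using inverse_p_less_1 by linarith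
  then have "\<not> coprime k (int p)"
    using absval_of_int_coprime by fastforce
  then have "int p dvd k"
    using prime_p by (metis coprime_commute prime_imp_coprime prime_nat_int_transfer)
  then show ?case
    using k by (simp add: mult_dvd_mono mult.commute)
qed simp

lemma absval_le_if_p_power_dvd:
  assumes "int p ^ m dvd n"
  shows "absval (of_int n :: 'a) \<le> 1 / real p ^ m"
proof -
  obtain k where "n = k * int p ^ m"
    using assms by (metis dvdE mult.commute)
  then show ?thesis
    using absval_mult_le[OF absval_of_int_le_1, of "of_nat p ^ m" "1 / real p ^ m" k]
    by (simp add: absval_p_power)
qed

lemma p_power_tendsto_0: "(\<lambda>m. 1 / real p ^ m) \<longlonglongrightarrow> 0"
  using p_gt_1 LIMSEQ_divide_realpow_zero[of "real p" 1] by simp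

lemma p_power_less:
  assumes "0 < e"
  obtains m where "1 / real p ^ m < e"
  using order_tendstoD(2)[OF p_power_tendsto_0 assms] by (auto simp: eventually_sequentially)

section \<open>Limits and continuity\<close>

lemma tendsto_iff_absval: "(f \<longlongrightarrow> l) F \<longleftrightarrow> ((\<lambda>x. absval (f x - l)) \<longlongrightarrow> 0) F" for l :: 'a
  using tendsto_dist_iff[of f l F] by (subst (asm) dist_absval)

lemma tendsto_plus:
  fixes a b :: 'a
  assumes "(f \<longlongrightarrow> a) F" and "(g \<longlongrightarrow> b) F"
  shows "((\<lambda>x. f x + g x) \<longlongrightarrow> a + b) F"
  unfolding tendsto_iff_absval
proof (rule tendsto_sandwich[where f = "\<lambda>_. 0"])
  have "absval (f x + g x - (a + b)) \<le> absval (f x - a) + absval (g x - b)" for x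
  proof -
    have "f x + g x - (a + b) = (f x - a) + (g x - b)"
      by simp
    then show ?thesis
      by (metis absval_triangle)
  qed
  then show "\<forall>\<^sub>F x in F. absval (f x + g x - (a + b)) \<le> absval (f x - a) + absval (g x - b)"
    by simp
  show "((\<lambda>x. absval (f x - a) + absval (g x - b)) \<longlongrightarrow> 0) F"
    using assms tendsto_add[of _ 0 F _ 0] by (auto simp: tendsto_iff_absval)
qed auto

lemma tendsto_times:
  fixes a b :: 'a
  assumes "(f \<longlongrightarrow> a) F" and "(g \<longlongrightarrow> b) F"
  shows "((\<lambda>x. f x * g x) \<longlongrightarrow> a * b) F"
  unfolding tendsto_iff_absval
proof (rule tendsto_sandwich[where f = "\<lambda>_. 0"])
  have "absval (f x * g x - a * b) \<le> absval (f x) * absval (g x - b) + absval b * absval (f x - a)"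
    for x
  proof -
    have "f x * g x - a * b = f x * (g x - b) + b * (f x - a)"
      by (simp add: algebra_simps)
    then have "absval (f x * g x - a * b) \<le> absval (f x * (g x - b)) + absval (b * (f x - a))"
      by (metis absval_triangle)
    then show ?thesis
      by (simp add: absval_mult)
  qed
  then show "\<forall>\<^sub>F x in F. absval (f x * g x - a * b)
      \<le> absval (f x) * absval (g x - b) + absval b * absval (f x - a)"
    by simp
  have "((\<lambda>x. absval (f x)) \<longlongrightarrow> absval a) F"
    using assms(1) by (intro tendsto_intros)
  then have "((\<lambda>x. absval (f x) * absval (g x - b) + absval b * absval (f x - a)) \<longlongrightarrow>
      absval a * 0 + absval b * 0) F"
    using assms unfolding tendsto_iff_absval[of f] tendsto_iff_absval[of g]
    by (intro tendsto_add tendsto_mult tendsto_const)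
  then show "((\<lambda>x. absval (f x) * absval (g x - b) + absval b * absval (f x - a)) \<longlongrightarrow> 0) F"
    by simp
qed auto

lemma continuous_on_plus:
  fixes f g :: "'b :: topological_space \<Rightarrow> 'a"
  shows "continuous_on S f \<Longrightarrow> continuous_on S g \<Longrightarrow> continuous_on S (\<lambda>x. f x + g x)"
  unfolding continuous_on_def by (auto intro: tendsto_plus)

lemma continuous_on_times:
  fixes f g :: "'b :: topological_space \<Rightarrow> 'a"
  shows "continuous_on S f \<Longrightarrow> continuous_on S g \<Longrightarrow> continuous_on S (\<lambda>x. f x * g x)"
  unfolding continuous_on_def by (auto intro: tendsto_times)

lemma continuous_on_minus':
  fixes f g :: "'b :: topological_space \<Rightarrow> 'a"
  assumes "continuous_on S f" and "continuous_on S g"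
  shows "continuous_on S (\<lambda>x. f x - g x)"
  using continuous_on_plus[OF assms(1) continuous_on_times[OF continuous_on_const[of _ "-1"] assms(2)]]
  by simp

lemma continuous_on_sum':
  fixes f :: "'i \<Rightarrow> 'b :: topological_space \<Rightarrow> 'a"
  assumes "\<And>i. i \<in> I \<Longrightarrow> continuous_on S (f i)"
  shows "continuous_on S (\<lambda>x. \<Sum>i\<in>I. f i x)"
  using assms
  by (induction I rule: infinite_finite_induct) (auto intro: continuous_on_plus)

lemma continuous_on_prod':
  fixes f :: "'i \<Rightarrow> 'b :: topological_space \<Rightarrow> 'a"
  assumes "\<And>i. i \<in> I \<Longrightarrow> continuous_on S (f i)"
  shows "continuous_on S (\<lambda>x. \<Prod>i\<in>I. f i x)"
  using assms
  by (induction I rule: infinite_finite_induct) (auto intro: continuous_on_times)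

lemma continuous_on_gbinomial: "continuous_on S (\<lambda>x :: 'a. x gchoose n)"
proof -
  have "continuous_on S (\<lambda>x :: 'a. (\<Prod>i = 0..<n. x - of_nat i) * inverse (fact n))"
    by (intro continuous_on_times continuous_on_prod' continuous_on_minus' continuous_on_id
        continuous_on_const)
  then show ?thesis
    by (simp add: gbinomial_prod_rev divide_inverse)
qed

lemma absval_limit_le:
  fixes l :: 'a
  assumes "s \<longlonglongrightarrow> l" and "\<And>n. absval (s n) \<le> B"
  shows "absval l \<le> B"
  using assms by (intro tendsto_upperbound[of "\<lambda>n. absval (s n)"] tendsto_dist tendsto_const) auto

text \<open>
  The ultrametric inequality bounds \<open>s (N + k) - s N\<close> by the largest of the consecutive differences
  in between, so these alone decide whether \<open>s\<close> is Cauchy.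
\<close>

lemma convergent_if_diff_tendsto_0:
  fixes s :: "nat \<Rightarrow> 'a"
  assumes "(\<lambda>n. s (Suc n) - s n) \<longlonglongrightarrow> 0"
  shows "convergent s"
proof -
  have "Cauchy s"
  proof (rule metric_CauchyI)
    fix e :: real
    assume "0 < e"
    then obtain N where N: "\<And>n. n \<ge> N \<Longrightarrow> absval (s (Suc n) - s n) < e / 2"
      using assms metric_LIMSEQ_D[of "\<lambda>n. s (Suc n) - s n" 0 "e / 2"] by auto
    have tail: "absval (s (N + k) - s N) \<le> e / 2" for k
    proof (induction k)
      case (Suc k)
      have "s (N + Suc k) - s N = (s (Suc (N + k)) - s (N + k)) + (s (N + k) - s N)"
        by simp
      moreover have "absval (s (Suc (N + k)) - s (N + k)) \<le> e / 2"
        using N[of "N + k"] by simp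
      ultimately show ?case
        using Suc.IH absval_add_le by metis
    qed (use \<open>0 < e\<close> in simp)
    show "\<exists>M. \<forall>m\<ge>M. \<forall>n\<ge>M. dist (s m) (s n) < e"
    proof (intro exI allI impI)
      fix m n
      assume "N \<le> m" "N \<le> n"
      then have "absval (s m - s N) \<le> e / 2" "absval (s n - s N) \<le> e / 2"
        using tail[of "m - N"] tail[of "n - N"] by auto
      then have "absval ((s m - s N) - (s n - s N)) \<le> e / 2"
        by (rule absval_diff_le)
      then have "dist (s m) (s n) \<le> e / 2"
        by (subst dist_absval) simp
      then show "dist (s m) (s n) < e"
        using \<open>0 < e\<close> by linarith
    qed
  qed
  then show ?thesis
    by (rule Cauchy_convergent)
qed

section \<open>The p-adic integers\<close>

lemma of_int_in_Zp: "(of_int n :: 'a) \<in> Zp"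
  unfolding Zp_def by (intro subsetD[OF closure_subset] Ints_of_int)

lemma of_nat_in_Zp: "(of_nat n :: 'a) \<in> Zp"
  using of_int_in_Zp[of "int n"] by simp

lemma Zp_approx_int:
  assumes "(x :: 'a) \<in> Zp"
  obtains n :: int where "absval (x - of_int n) \<le> 1 / real p ^ m"
proof -
  have "0 < 1 / real p ^ m"
    using p_pos by simp
  then obtain y :: 'a where "y \<in> \<int>" "dist y x < 1 / real p ^ m"
    using assms unfolding Zp_def closure_approachable by blast
  then show thesis
    using that dist_absval[of x y] by (metis Ints_cases dist_commute less_imp_le)
qed

lemma Zp_approx:
  assumes "(x :: 'a) \<in> Zp"
  obtains n :: nat where "n < p ^ m" "absval (x - of_nat n) \<le> 1 / real p ^ m"
proof -
  obtain k :: int where k: "absval (x - of_int k) \<le> 1 / real p ^ m"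
    using Zp_approx_int[OF assms] .
  define n where "n = nat (k mod int p ^ m)"
  have pos: "0 < int p ^ m"
    using p_pos by simp
  then have n: "int n = k mod int p ^ m"
    by (simp add: n_def)
  then have "int p ^ m dvd k - int n"
    by (simp add: minus_mod_eq_mult_div)
  then have "absval (of_int (k - int n) :: 'a) \<le> 1 / real p ^ m"
    by (rule absval_le_if_p_power_dvd)
  then have "absval (x - of_int k + of_int (k - int n)) \<le> 1 / real p ^ m"
    using k by (intro absval_add_le)
  then have "absval (x - of_nat n) \<le> 1 / real p ^ m"
    by simp
  moreover have "int n < int p ^ m"
    using n pos by simp
  then have "n < p ^ m"
    by (metis of_nat_less_iff of_nat_power)
  ultimately show thesis
    using that by blast
qed

lemma ZpI:
  assumes "\<And>m. \<exists>n :: int. absval (x - of_int n) \<le> 1 / real p ^ m"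
  shows "(x :: 'a) \<in> Zp"
  unfolding Zp_def closure_approachable
proof (intro allI impI)
  fix e :: real
  assume "0 < e"
  then obtain m where "1 / real p ^ m < e"
    using p_power_less by blast
  moreover obtain n :: int where "absval (x - of_int n) \<le> 1 / real p ^ m"
    using assms by blast
  ultimately have "dist (of_int n) x < e"
    using dist_absval[of x "of_int n"] by (simp add: dist_commute)
  then show "\<exists>y\<in>\<int>. dist y x < e"
    using Ints_of_int by blast
qed

lemma absval_Zp_le_1:
  assumes "(x :: 'a) \<in> Zp"
  shows "absval x \<le> 1"
proof -
  obtain n :: int where "absval (x - of_int n) \<le> 1"
    using Zp_approx_int[OF assms, of 0] by auto
  then have "absval (x - of_int n + of_int n) \<le> 1"
    by (intro absval_add_le absval_of_int_le_1)
  then show ?thesis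
    by simp
qed

lemma Zp_mult:
  assumes "(x :: 'a) \<in> Zp" and "y \<in> Zp"
  shows "x * y \<in> Zp"
proof (rule ZpI)
  fix m
  obtain n k :: int where "absval (x - of_int n) \<le> 1 / real p ^ m"
      "absval (y - of_int k) \<le> 1 / real p ^ m"
    using assms Zp_approx_int by metis
  then have "absval (x * (y - of_int k) + of_int k * (x - of_int n)) \<le> 1 / real p ^ m"
    using assms by (intro absval_add_le absval_mult_le absval_Zp_le_1 absval_of_int_le_1)
  also have "x * (y - of_int k) + of_int k * (x - of_int n) = x * y - of_int (k * n)"
    by (simp add: algebra_simps)
  finally show "\<exists>n :: int. absval (x * y - of_int n) \<le> 1 / real p ^ m"
    by blast
qed

text \<open>
  The coset \<open>a + p\<^sup>m \<int>\<^sub>p\<close> is a ball. For the inclusion from right to left, an integer close enough to \<open>x\<close>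
  is congruent to \<open>a\<close> modulo \<open>p\<^sup>m\<close>, so that \<open>(x - a) / p\<^sup>m\<close> is still a limit of integers.
\<close>

lemma Zp_ball_eq:
  "(\<lambda>y :: 'a. of_nat a + of_nat p ^ m * y) ` Zp = {x \<in> Zp. absval (x - of_nat a) \<le> 1 / real p ^ m}"
  (is "?L = ?R")
proof (intro equalityI subsetI)
  fix x :: 'a
  assume "x \<in> ?L"
  then obtain y where y: "y \<in> Zp" "x = of_nat a + of_nat p ^ m * y"
    by blast
  have "x \<in> Zp"
  proof (rule ZpI)
    fix k
    obtain n :: int where "absval (y - of_int n) \<le> 1 / real p ^ k"
      using y(1) Zp_approx_int by metis
    then have "absval (of_int (int p ^ m) * (y - of_int n)) \<le> 1 / real p ^ k"
      by (intro absval_mult_le absval_of_int_le_1)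
    then have "absval (x - of_int (int a + int p ^ m * n)) \<le> 1 / real p ^ k"
      using y(2) by (simp add: algebra_simps)
    then show "\<exists>n :: int. absval (x - of_int n) \<le> 1 / real p ^ k"
      by blast
  qed
  moreover have "absval (y * of_nat p ^ m) \<le> 1 / real p ^ m"
    using absval_mult_le[OF absval_Zp_le_1[OF y(1)]] absval_p_power[of m] by simp
  ultimately show "x \<in> ?R"
    using y(2) by (simp add: mult.commute)
next
  fix x :: 'a
  assume x: "x \<in> ?R"
  define y where "y = (x - of_nat a) / of_nat p ^ m"
  have p0: "(of_nat p :: 'a) \<noteq> 0"
    using p_pos by simp
  have "y \<in> Zp"
  proof (rule ZpI)
    fix k
    obtain n :: int where n: "absval (x - of_int n) \<le> 1 / real p ^ (m + k)"
      using x Zp_approx_int by blast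
    have "1 / real p ^ (m + k) \<le> 1 / real p ^ m"
      using p_gt_1 by (intro divide_left_mono) (auto simp: power_increasing)
    then have "absval ((x - of_nat a) - (x - of_int n)) \<le> 1 / real p ^ m"
      using x n by (intro absval_diff_le[of "x - of_nat a" _ "x - of_int n"]) auto
    then have "absval (of_int (n - int a) :: 'a) \<le> 1 / real p ^ m"
      by simp
    then obtain l where l: "n - int a = int p ^ m * l"
      using p_power_dvd_if_absval_le by blast
    have "(of_int n :: 'a) = of_int (int a + int p ^ m * l)"
      using l by (metis add.commute diff_add_cancel)
    then have "y - of_int l = (x - of_int n) / of_nat p ^ m"
      using p0 unfolding y_def by (simp add: field_simps)
    then have "absval (y - of_int l) = absval (x - of_int n) * real p ^ m"
      by (simp add: absval_divide absval_p_power)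
    also have "\<dots> \<le> 1 / real p ^ (m + k) * real p ^ m"
      using n by (intro mult_right_mono) auto
    also have "\<dots> = 1 / real p ^ k"
      using p_pos by (simp add: power_add)
    finally show "\<exists>n :: int. absval (y - of_int n) \<le> 1 / real p ^ k"
      by blast
  qed
  moreover have "x = of_nat a + of_nat p ^ m * y"
    using p0 by (simp add: y_def)
  ultimately show "x \<in> ?L"
    by blast
qed

text \<open>
  The residues \<open>0, \<dots>, p\<^sup>m - 1\<close> form a \<open>1 / p\<^sup>m\<close>-net. Compactness is used through its consequence that
  continuous functions are bounded and uniformly continuous.
\<close>

lemma compact_Zp: "compact (Zp :: 'a set)"
  unfolding compact_eq_totally_bounded
proof (intro conjI allI impI)
  show "complete (Zp :: 'a set)"
    unfolding Zp_def by (simp add: complete_eq_closed)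
  fix e :: real
  assume "0 < e"
  then obtain m where m: "1 / real p ^ m < e"
    using p_power_less by blast
  have "(Zp :: 'a set) \<subseteq> (\<Union>x \<in> of_nat ` {..<p ^ m}. ball x e)"
  proof
    fix x :: 'a
    assume "x \<in> Zp"
    then obtain n where n: "n < p ^ m" "absval (x - of_nat n) \<le> 1 / real p ^ m"
      using Zp_approx by blast
    have "dist (of_nat n) x < e"
      using m n(2) dist_absval[of x "of_nat n"] by (simp add: dist_commute)
    then show "x \<in> (\<Union>x \<in> of_nat ` {..<p ^ m}. ball x e)"
      using n(1) by auto
  qed
  then show "\<exists>k. finite k \<and> (Zp :: 'a set) \<subseteq> (\<Union>x\<in>k. ball x e)"
    by (intro exI[of _ "of_nat ` {..<p ^ m}"]) simp
qed

text \<open>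
  If \<open>\<bar>x\<bar> = 1\<close>, an integer approximating \<open>x\<close> modulo \<open>p\<^sup>m\<close> is prime to \<open>p\<close>, and its inverse modulo \<open>p\<^sup>m\<close>
  approximates \<open>inverse x\<close> equally well.
\<close>

lemma Zp_units_eq: "Zp_units = {x \<in> Zp. absval (x :: 'a) = 1}"
proof (intro equalityI subsetI)
  fix x :: 'a
  assume "x \<in> Zp_units"
  then obtain y where xy: "x \<in> Zp" "y \<in> Zp" "x * y = 1"
    unfolding Zp_units_def by blast
  then have "1 = absval x * absval y" "absval x \<le> 1" "absval y \<le> 1"
    using absval_mult[of x y] by (auto simp: absval_Zp_le_1)
  then have "absval x = 1"
    by (metis mult_left_le mult_left_le_one_le order_antisym zero_le_dist)
  then show "x \<in> {x \<in> Zp. absval x = 1}"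
    using xy by simp
next
  fix x :: 'a
  assume x: "x \<in> {x \<in> Zp. absval x = 1}"
  then have x0: "x \<noteq> 0"
    by auto
  have "inverse x \<in> Zp"
  proof (rule ZpI)
    fix k
    \<comment> \<open>The successor makes the error strictly smaller than \<open>1\<close>, so that the approximating integer is
      prime to \<open>p\<close> also for \<open>k = 0\<close>.\<close>
    define m where "m = Suc k"
    obtain n :: int where n: "absval (x - of_int n) \<le> 1 / real p ^ m"
      using x Zp_approx_int by blast
    have lt: "1 / real p ^ m < 1"
      using p_gt_1 unfolding m_def by (simp del: power_Suc add: one_less_power)
    have "coprime (int p) n"
    proof (rule ccontr)
      assume "\<not> coprime (int p) n"
      then have "int p dvd n"
        using prime_imp_coprime[of "int p" n] prime_p by simp blast
      then have "absval (of_int n :: 'a) \<le> 1 / real p"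
        using absval_le_if_p_power_dvd[of 1] by simp
      then have "absval (x - of_int n + of_int n) < 1"
        using absval_add_le_max[of "x - of_int n" "of_int n"] n lt inverse_p_less_1 by linarith
      then show False
        using x by simp
    qed
    then have "coprime n (int p ^ m)"
      by (simp add: ac_simps)
    then obtain u v where uv: "u * n + v * int p ^ m = 1"
      by (metis bezout_int coprime_iff_gcd_eq_1)
    have "absval (of_int (v * int p ^ m) :: 'a) \<le> 1 / real p ^ m"
      by (intro absval_le_if_p_power_dvd) simp
    moreover have "absval (of_int u * (x - of_int n)) \<le> 1 / real p ^ m"
      using n by (intro absval_mult_le absval_of_int_le_1)
    ultimately have "absval (of_int (v * int p ^ m) - of_int u * (x - of_int n)) \<le> 1 / real p ^ m"
      by (rule absval_diff_le)
    also have "of_int (v * int p ^ m) - of_int u * (x - of_int n) = 1 - of_int u * x"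
    proof -
      have "(of_int (v * int p ^ m) :: 'a) = 1 - of_int u * of_int n"
        using uv by (metis add_diff_cancel_left' of_int_1 of_int_diff of_int_mult)
      then show ?thesis
        by (simp add: algebra_simps)
    qed
    also have "1 - of_int u * x = x * (inverse x - of_int u)"
      using x0 by (simp add: algebra_simps)
    finally have "absval (inverse x - of_int u) \<le> 1 / real p ^ m"
      using x by (simp add: absval_mult)
    also have "\<dots> \<le> 1 / real p ^ k"
      using p_gt_1 by (simp add: m_def field_simps)
    finally show "\<exists>n :: int. absval (inverse x - of_int n) \<le> 1 / real p ^ k"
      by blast
  qed
  then show "x \<in> Zp_units"
    using x x0 unfolding Zp_units_def by (auto intro!: bexI[of _ "inverse x"])
qed

lemma absval_Zp_units: "x \<in> Zp_units \<Longrightarrow> absval (x :: 'a) = 1"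
  by (simp add: Zp_units_eq)

lemma Zp_units_mult: "(x :: 'a) \<in> Zp_units \<Longrightarrow> y \<in> Zp_units \<Longrightarrow> x * y \<in> Zp_units"
  by (auto simp: Zp_units_eq Zp_mult absval_mult)

lemma of_nat_in_Zp_units: "coprime n p \<Longrightarrow> (of_nat n :: 'a) \<in> Zp_units"
  by (simp add: Zp_units_eq of_nat_in_Zp absval_of_nat_coprime)

lemma one_in_Zp_units: "(1 :: 'a) \<in> Zp_units"
  using of_nat_in_Zp_units[of 1] by simp

lemma mult_unit_in_Zp_units_iff:
  "u \<in> Zp_units \<Longrightarrow> x \<in> Zp \<Longrightarrow> u * x \<in> Zp_units \<longleftrightarrow> (x :: 'a) \<in> Zp_units"
  by (auto simp: Zp_units_eq Zp_mult absval_mult)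

lemma compact_Zp_units: "compact (Zp_units :: 'a set)"
proof -
  have "closed {x :: 'a. absval x = 1}"
    by (intro closed_Collect_eq continuous_intros)
  then have "compact (Zp \<inter> {x :: 'a. absval x = 1})"
    using compact_Zp by (rule compact_Int_closed[rotated])
  moreover have "(Zp_units :: 'a set) = Zp \<inter> {x :: 'a. absval x = 1}"
    unfolding Zp_units_eq by blast
  ultimately show ?thesis
    by simp
qed

lemma absval_eq_if_close:
  assumes "absval (x - y) < absval (x :: 'a)"
  shows "absval y = absval x"
proof -
  have "absval x \<le> max (absval (x - y)) (absval y)"
    using absval_add_le_max[of "x - y" y] by simp
  moreover have "absval y \<le> max (absval x) (absval (x - y))"
    using absval_diff_le_max[of x "x - y"] by simp
  ultimately show ?thesis
    using assms by linarith
qed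

text \<open>
  The absolute value is locally constant away from \<open>0\<close>, so the units are both open and closed in the
  p-adic integers.
\<close>

lemma continuous_on_extend_by_zero:
  fixes f :: "'a \<Rightarrow> 'a"
  assumes "continuous_on Zp_units f"
  shows "continuous_on Zp (\<lambda>x. if x \<in> Zp_units then f x else 0)"
  unfolding continuous_on_iff
proof (intro ballI allI impI)
  fix x :: 'a and e :: real
  assume x: "x \<in> Zp" and e: "0 < e"
  show "\<exists>d>0. \<forall>x'\<in>Zp. dist x' x < d \<longrightarrow>
      dist (if x' \<in> Zp_units then f x' else 0) (if x \<in> Zp_units then f x else 0) < e"
  proof (cases "x \<in> Zp_units")
    case True
    then obtain d where d: "d > 0" "\<And>x'. x' \<in> Zp_units \<Longrightarrow> dist x' x < d \<Longrightarrow> dist (f x') (f x) < e"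
      using assms e unfolding continuous_on_iff by blast
    have "x' \<in> Zp_units" if "x' \<in> Zp" "dist x' x < 1" for x'
    proof -
      have "absval (x - x') < absval x"
        using that(2) absval_Zp_units[OF True] dist_absval[of x x'] dist_commute[of x x'] by linarith
      then have "absval x' = absval x"
        by (rule absval_eq_if_close)
      then show ?thesis
        using that(1) True unfolding Zp_units_eq by simp
    qed
    with True d show ?thesis
      by (intro exI[of _ "min d 1"]) auto
  next
    case False
    have "x' \<notin> Zp_units" if "x' \<in> Zp" "dist x' x < 1" for x'
    proof
      assume x': "x' \<in> Zp_units"
      then have "absval (x' - x) < absval x'"
        using that(2) absval_Zp_units[OF x'] dist_absval[of x' x] by linarith
      then have "absval x = absval x'"
        by (rule absval_eq_if_close)
      then show False
        using False x x' unfolding Zp_units_eq by simp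
    qed
    with False e show ?thesis
      by (intro exI[of _ 1]) auto
  qed
qed

text \<open>
  On elements of absolute value \<open>1\<close> inversion is an isometry.
\<close>

lemma continuous_on_inverse_units: "continuous_on Zp_units (inverse :: 'a \<Rightarrow> 'a)"
  unfolding continuous_on_iff
proof (intro ballI allI impI)
  fix x :: 'a and e :: real
  assume x: "x \<in> Zp_units" and e: "0 < e"
  have "dist (inverse x') (inverse x) = dist x' x" if x': "x' \<in> Zp_units" for x'
  proof -
    have n: "x \<noteq> 0" "x' \<noteq> 0" "absval x = 1" "absval x' = 1"
      using x x' absval_Zp_units by fastforce+
    then have "inverse x' - inverse x = (x - x') * (inverse x * inverse x')"
      by (simp add: field_simps)
    then have "absval (inverse x' - inverse x) = absval (x - x')"
      using n by (simp add: absval_mult absval_inverse)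
    then show ?thesis
      by (metis dist_absval dist_commute)
  qed
  with e show "\<exists>d>0. \<forall>x'\<in>Zp_units. dist x' x < d \<longrightarrow> dist (inverse x') (inverse x) < e"
    by auto
qed

section \<open>Bounded measures\<close>

lemma bounded_measuresI:
  fixes X :: "'a set"
  assumes "\<And>f. \<not> continuous_on X f \<Longrightarrow> D f = 0"
    and "\<And>f g. continuous_on X f \<Longrightarrow> continuous_on X g \<Longrightarrow> D (\<lambda>x. f x + g x) = D f + D g"
    and "\<And>k f. continuous_on X f \<Longrightarrow> D (\<lambda>x. k * f x) = k * D f"
    and "\<And>f B. continuous_on X f \<Longrightarrow> (\<And>x. x \<in> X \<Longrightarrow> absval (f x) \<le> B) \<Longrightarrow> absval (D f) \<le> C * B"
  shows "D \<in> bounded_measures X"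
  unfolding bounded_measures_def using assms by blast

lemma
  fixes X :: "'a set"
  assumes "D \<in> bounded_measures X"
  shows measure_not_continuous: "\<not> continuous_on X f \<Longrightarrow> D f = 0"
    and measure_add: "continuous_on X f \<Longrightarrow> continuous_on X g \<Longrightarrow> D (\<lambda>x. f x + g x) = D f + D g"
    and measure_scale: "continuous_on X f \<Longrightarrow> D (\<lambda>x. k * f x) = k * D f"
  using assms unfolding bounded_measures_def by blast+

lemma measure_bound:
  fixes X :: "'a set"
  assumes "D \<in> bounded_measures X"
  obtains C where "0 \<le> C" and
    "\<And>f B. continuous_on X f \<Longrightarrow> (\<And>x. x \<in> X \<Longrightarrow> absval (f x) \<le> B) \<Longrightarrow> absval (D f) \<le> C * B"
proof -
  obtain C where C: "\<forall>f B. continuous_on X f \<longrightarrow> (\<forall>x\<in>X. absval (f x) \<le> B) \<longrightarrow> absval (D f) \<le> C * B"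
    using assms unfolding bounded_measures_def by blast
  have "absval (D (\<lambda>_. 0)) \<le> C * 1"
    using C[rule_format, of "\<lambda>_. 0" 1] by simp
  then have "0 \<le> C"
    using zero_le_dist[of "D (\<lambda>_. 0)" 0] by linarith
  then show thesis
    using that[of C] C by blast
qed

lemma measure_diff:
  fixes X :: "'a set"
  assumes D: "D \<in> bounded_measures X" and f: "continuous_on X f" and g: "continuous_on X g"
  shows "D (\<lambda>x. f x - g x) = D f - D g"
proof -
  have "continuous_on X (\<lambda>x. - 1 * g x)"
    by (intro continuous_on_times continuous_on_const g)
  then have "D (\<lambda>x. f x + (- 1 * g x)) = D f + D (\<lambda>x. - 1 * g x)"
    using D f by (intro measure_add)
  also have "D (\<lambda>x. - 1 * g x) = - 1 * D g"
    using D g by (rule measure_scale)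
  finally show ?thesis
    by simp
qed

text \<open>
  Two functions with equal values on \<open>X\<close> have a difference bounded by \<open>B = 0\<close> there, and a measure
  kills such a difference.
\<close>

lemma measure_cong:
  fixes X :: "'a set"
  assumes D: "D \<in> bounded_measures X" and eq: "\<And>x. x \<in> X \<Longrightarrow> f x = g x"
  shows "D f = D g"
proof (cases "continuous_on X f")
  case True
  then have g: "continuous_on X g"
    using eq continuous_on_cong by metis
  obtain C where C: "\<And>f B. continuous_on X f \<Longrightarrow> (\<And>x. x \<in> X \<Longrightarrow> absval (f x) \<le> B) \<Longrightarrow> absval (D f) \<le> C * B"
    using D by (rule measure_bound) blast
  have "absval (D (\<lambda>x. f x - g x)) \<le> C * 0"
    using True g eq by (intro C continuous_on_minus') auto
  then show ?thesis
    using measure_diff[OF D True g] by simp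
next
  case False
  moreover from False have "\<not> continuous_on X g"
    using eq continuous_on_cong by metis
  ultimately show ?thesis
    using D by (simp add: measure_not_continuous)
qed

lemma measure_zero: "D \<in> bounded_measures X \<Longrightarrow> D (\<lambda>_. 0) = 0" for X :: "'a set"
  using measure_scale[of D X "\<lambda>_. 0" 0] by simp

lemma measure_sum:
  fixes X :: "'a set" and k :: "'i \<Rightarrow> 'a"
  assumes D: "D \<in> bounded_measures X" and "\<And>i. i \<in> I \<Longrightarrow> continuous_on X (f i)"
  shows "D (\<lambda>x. \<Sum>i\<in>I. k i * f i x) = (\<Sum>i\<in>I. k i * D (f i))"
  using assms(2)
proof (induction I rule: infinite_finite_induct)
  case (insert i I)
  have "continuous_on X (\<lambda>x. k i * f i x)" "continuous_on X (\<lambda>x. \<Sum>i\<in>I. k i * f i x)"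
    using insert.prems by (auto intro!: continuous_on_times continuous_on_sum')
  then have "D (\<lambda>x. k i * f i x + (\<Sum>i\<in>I. k i * f i x)) = k i * D (f i) + (\<Sum>i\<in>I. k i * D (f i))"
    using insert by (simp add: measure_add[OF D] measure_scale[OF D])
  then show ?case
    using insert.hyps by simp
qed (auto simp: measure_zero[OF D])

lemma measure_eqI_dense:
  fixes X :: "'a set"
  assumes D1: "D1 \<in> bounded_measures X" and D2: "D2 \<in> bounded_measures X"
    and dense: "\<And>f e. continuous_on X f \<Longrightarrow> 0 < e \<Longrightarrow>
      \<exists>g. continuous_on X g \<and> D1 g = D2 g \<and> (\<forall>x\<in>X. absval (f x - g x) \<le> e)"
  shows "D1 = D2"
proof
  fix f :: "'a \<Rightarrow> 'a"
  show "D1 f = D2 f"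
  proof (cases "continuous_on X f")
    case f: True
    obtain C1 where C1: "0 \<le> C1"
      "\<And>f B. continuous_on X f \<Longrightarrow> (\<And>x. x \<in> X \<Longrightarrow> absval (f x) \<le> B) \<Longrightarrow> absval (D1 f) \<le> C1 * B"
      using D1 by (rule measure_bound) blast
    obtain C2 where C2: "0 \<le> C2"
      "\<And>f B. continuous_on X f \<Longrightarrow> (\<And>x. x \<in> X \<Longrightarrow> absval (f x) \<le> B) \<Longrightarrow> absval (D2 f) \<le> C2 * B"
      using D2 by (rule measure_bound) blast
    have le: "absval (D1 f - D2 f) \<le> (C1 + C2) * e" if e: "0 < e" for e
    proof -
      obtain g where g: "continuous_on X g" "D1 g = D2 g" "\<And>x. x \<in> X \<Longrightarrow> absval (f x - g x) \<le> e"
        using dense[OF f e] by blast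
      have "absval (D1 f - D1 g) \<le> C1 * e"
        using C1(2)[OF continuous_on_minus'[OF f g(1)] g(3)] measure_diff[OF D1 f g(1)] by simp
      moreover have "absval (D2 f - D2 g) \<le> C2 * e"
        using C2(2)[OF continuous_on_minus'[OF f g(1)] g(3)] measure_diff[OF D2 f g(1)] by simp
      moreover have "0 \<le> C1 * e" "0 \<le> C2 * e"
        using C1 C2 e by auto
      moreover have "D1 f - D2 f = (D1 f - D1 g) - (D2 f - D2 g)"
        using g(2) by simp
      ultimately show ?thesis
        using absval_diff_le_max[of "D1 f - D1 g" "D2 f - D2 g"] by (simp add: distrib_right)
    qed
    have "absval (D1 f - D2 f) \<le> 0 + e" if e: "0 < e" for e
    proof -
      have "absval (D1 f - D2 f) \<le> (C1 + C2) * (e / (C1 + C2 + 1))"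
        using C1(1) C2(1) e by (intro le) simp
      also have "\<dots> \<le> e"
        using C1(1) C2(1) e by (simp add: field_simps)
      finally show ?thesis
        by simp
    qed
    then have "absval (D1 f - D2 f) \<le> 0"
      by (rule field_le_epsilon)
    then show ?thesis
      by simp
  qed (use D1 D2 in \<open>simp add: measure_not_continuous\<close>)
qed

lemma measure_combination:
  fixes X :: "'a set" and k :: "'i \<Rightarrow> 'a"
  assumes "\<And>i. i \<in> I \<Longrightarrow> D i \<in> bounded_measures X"
  shows "(\<lambda>f. \<Sum>i\<in>I. k i * D i f) \<in> bounded_measures X"
  using assms
proof (induction I rule: infinite_finite_induct)
  case (insert i I)
  let ?S = "\<lambda>f. \<Sum>i\<in>I. k i * D i f"
  have Di: "D i \<in> bounded_measures X" and S: "?S \<in> bounded_measures X"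
    using insert by auto
  obtain C1 where C1: "0 \<le> C1"
    "\<And>f B. continuous_on X f \<Longrightarrow> (\<And>x. x \<in> X \<Longrightarrow> absval (f x) \<le> B) \<Longrightarrow> absval (D i f) \<le> C1 * B"
    using Di by (rule measure_bound) blast
  obtain C2 where C2: "0 \<le> C2"
    "\<And>f B. continuous_on X f \<Longrightarrow> (\<And>x. x \<in> X \<Longrightarrow> absval (f x) \<le> B) \<Longrightarrow> absval (?S f) \<le> C2 * B"
    using S by (rule measure_bound) blast
  have "(\<lambda>f. k i * D i f + ?S f) \<in> bounded_measures X"
  proof (rule bounded_measuresI[where C = "absval (k i) * C1 + C2"])
    fix f :: "'a \<Rightarrow> 'a" and B
    assume f: "continuous_on X f" and B: "\<And>x. x \<in> X \<Longrightarrow> absval (f x) \<le> B"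
    have "absval (k i * D i f) \<le> absval (k i) * (C1 * B)"
      using C1(2)[OF f B] by (simp add: absval_mult mult_left_mono)
    moreover have "absval (?S f) \<le> C2 * B"
      using C2(2)[OF f B] .
    ultimately show "absval (k i * D i f + ?S f) \<le> (absval (k i) * C1 + C2) * B"
      using absval_triangle[of "k i * D i f" "?S f"] by (simp add: algebra_simps)
  qed (simp_all add: measure_not_continuous[OF Di] measure_not_continuous[OF S]
      measure_add[OF Di] measure_add[OF S] measure_scale[OF Di] measure_scale[OF S] algebra_simps)
  then show ?case
    using insert.hyps by simp
next
  case empty
  show ?case
    by (rule bounded_measuresI[where C = 0]) auto
next
  case (infinite I)
  show ?case
    using infinite by (intro bounded_measuresI[where C = 0]) auto
qed

lemma measure_diff_scaled:
  fixes X :: "'a set"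
  assumes "D1 \<in> bounded_measures X" and "D2 \<in> bounded_measures X"
  shows "(\<lambda>f. D1 f - k * D2 f) \<in> bounded_measures X"
  using measure_combination[of "{True, False}" "\<lambda>b. if b then D1 else D2" X "\<lambda>b. if b then 1 else - k"]
    assms by simp

lemma measure_pullback:
  fixes X :: "'a set"
  assumes D: "D \<in> bounded_measures X" and h: "continuous_on X h" "h ` X \<subseteq> X"
  shows "(\<lambda>f. if continuous_on X f then D (\<lambda>x. f (h x)) else 0) \<in> bounded_measures X"
proof -
  obtain C where C: "\<And>f B. continuous_on X f \<Longrightarrow> (\<And>x. x \<in> X \<Longrightarrow> absval (f x) \<le> B) \<Longrightarrow> absval (D f) \<le> C * B"
    using D by (rule measure_bound) blast
  have comp: "continuous_on X (\<lambda>x. f (h x))" if "continuous_on X f" for f :: "'a \<Rightarrow> 'a"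
    using continuous_on_compose2[OF that h] .
  show ?thesis
  proof (rule bounded_measuresI[where C = C])
    fix f :: "'a \<Rightarrow> 'a" and B
    assume "continuous_on X f" "\<And>x. x \<in> X \<Longrightarrow> absval (f x) \<le> B"
    then show "absval (if continuous_on X f then D (\<lambda>x. f (h x)) else 0) \<le> C * B"
      using C[OF comp, of f B] h(2) by (simp add: image_subset_iff)
  qed (simp_all add: continuous_on_plus continuous_on_times continuous_on_const
      measure_add[OF D] measure_scale[OF D] comp)
qed

lemma continuous_on_mult_left: "continuous_on X (\<lambda>x :: 'a. u * x)"
  by (intro continuous_on_times continuous_on_const continuous_on_id)

text \<open>
  Both existence results below construct a measure as a limit of finite sums \<open>L N\<close> of point
  evaluations; the ultrametric property reduces convergence to that of consecutive differences.
\<close>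

lemma measure_limit:
  fixes X :: "'a set" and L :: "nat \<Rightarrow> ('a \<Rightarrow> 'a) \<Rightarrow> 'a"
  assumes add: "\<And>N f g. L N (\<lambda>x. f x + g x) = L N f + L N g"
    and scale: "\<And>N k f. L N (\<lambda>x. k * f x) = k * L N f"
    and bound: "\<And>N f B. (\<And>x. x \<in> X \<Longrightarrow> absval (f x) \<le> B) \<Longrightarrow> absval (L N f) \<le> B"
    and conv: "\<And>f. continuous_on X f \<Longrightarrow> (\<lambda>N. L (Suc N) f - L N f) \<longlonglongrightarrow> 0"
  obtains D where "D \<in> bounded_measures X"
    and "\<And>f. continuous_on X f \<Longrightarrow> (\<lambda>N. L N f) \<longlonglongrightarrow> D f"
    and "\<And>f B. continuous_on X f \<Longrightarrow> (\<And>x. x \<in> X \<Longrightarrow> absval (f x) \<le> B) \<Longrightarrow> absval (D f) \<le> B"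
proof -
  define D where "D f = (if continuous_on X f then lim (\<lambda>N. L N f) else 0)" for f
  have D: "(\<lambda>N. L N f) \<longlonglongrightarrow> D f" if "continuous_on X f" for f
    using convergent_if_diff_tendsto_0[OF conv[OF that]] that
    by (simp add: D_def convergent_LIMSEQ_iff)
  have D_bound: "absval (D f) \<le> B"
    if "continuous_on X f" "\<And>x. x \<in> X \<Longrightarrow> absval (f x) \<le> B" for f B
    using absval_limit_le[OF D[OF that(1)]] bound that(2) by blast
  have "D \<in> bounded_measures X"
  proof (rule bounded_measuresI[where C = 1])
    fix f :: "'a \<Rightarrow> 'a"
    assume "\<not> continuous_on X f"
    then show "D f = 0"
      by (simp add: D_def)
  next
    fix f g :: "'a \<Rightarrow> 'a"
    assume f: "continuous_on X f" and g: "continuous_on X g"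
    have "(\<lambda>N. L N (\<lambda>x. f x + g x)) \<longlonglongrightarrow> D f + D g"
      unfolding add by (intro tendsto_plus D f g)
    then show "D (\<lambda>x. f x + g x) = D f + D g"
      using D[OF continuous_on_plus[OF f g]] LIMSEQ_unique by blast
  next
    fix k and f :: "'a \<Rightarrow> 'a"
    assume f: "continuous_on X f"
    have "(\<lambda>N. L N (\<lambda>x. k * f x)) \<longlonglongrightarrow> k * D f"
      unfolding scale by (intro tendsto_times D f tendsto_const)
    then show "D (\<lambda>x. k * f x) = k * D f"
      using D[OF continuous_on_times[OF continuous_on_const f]] LIMSEQ_unique by blast
  qed (simp add: D_bound)
  with D D_bound show thesis
    using that by blast
qed

lemma measure_restrict_units:
  fixes g :: "'a \<Rightarrow> 'a"
  assumes D: "D \<in> bounded_measures Zp" and g: "continuous_on Zp_units g"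
    and g1: "\<And>x. x \<in> Zp_units \<Longrightarrow> absval (g x) \<le> 1"
  shows "restrict_units g D \<in> Lambda_G"
proof -
  let ?e = "\<lambda>f x. if x \<in> Zp_units then g x * f x else 0"
  obtain C where C: "\<And>f B. continuous_on Zp f \<Longrightarrow> (\<And>x. x \<in> Zp \<Longrightarrow> absval (f x) \<le> B) \<Longrightarrow> absval (D f) \<le> C * B"
    using D by (rule measure_bound) blast
  have ext: "continuous_on Zp (?e f)" if "continuous_on Zp_units f" for f
    by (rule continuous_on_extend_by_zero[OF continuous_on_times[OF g that]])
  show ?thesis
  proof (rule bounded_measuresI[where C = C])
    fix f h :: "'a \<Rightarrow> 'a"
    assume f: "continuous_on Zp_units f" and h: "continuous_on Zp_units h"
    have "D (?e (\<lambda>x. f x + h x)) = D (\<lambda>x. ?e f x + ?e h x)"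
      by (rule arg_cong[of _ _ D]) (auto simp: algebra_simps)
    then show "restrict_units g D (\<lambda>x. f x + h x) = restrict_units g D f + restrict_units g D h"
      using f h by (simp add: restrict_units_def continuous_on_plus measure_add[OF D] ext)
  next
    fix f :: "'a \<Rightarrow> 'a" and k
    assume f: "continuous_on Zp_units f"
    have "D (?e (\<lambda>x. k * f x)) = D (\<lambda>x. k * ?e f x)"
      by (rule arg_cong[of _ _ D]) (auto simp: algebra_simps)
    then show "restrict_units g D (\<lambda>x. k * f x) = k * restrict_units g D f"
      using f by (simp add: restrict_units_def continuous_on_times continuous_on_const measure_scale[OF D] ext)
  next
    fix f :: "'a \<Rightarrow> 'a" and B
    assume f: "continuous_on Zp_units f" and B: "\<And>x. x \<in> Zp_units \<Longrightarrow> absval (f x) \<le> B"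
    have "0 \<le> B"
      using B[OF one_in_Zp_units] zero_le_dist order_trans by blast
    then have "absval (D (?e f)) \<le> C * B"
      using B g1 by (intro C ext f) (auto intro: absval_mult_le)
    then show "absval (restrict_units g D f) \<le> C * B"
      using f by (simp add: restrict_units_def)
  qed (simp add: restrict_units_def)
qed

lemma dirac_in_Lambda_G: "(u :: 'a) \<in> Zp_units \<Longrightarrow> dirac u \<in> Lambda_G"
  unfolding dirac_def
  by (rule bounded_measuresI[where C = 1])
    (auto simp: continuous_on_plus continuous_on_times continuous_on_const)

lemma r_meas_in_Lambda_G:
  assumes "coprime c p"
  shows "(r_meas c :: ('a \<Rightarrow> 'a) \<Rightarrow> 'a) \<in> Lambda_G"
  unfolding r_meas_def
  by (intro measure_diff_scaled dirac_in_Lambda_G one_in_Zp_units of_nat_in_Zp_units assms)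

section \<open>Multiplicative convolution\<close>

lemma translate_continuous:
  fixes f :: "'a \<Rightarrow> 'a"
  assumes "continuous_on Zp_units f" and "x \<in> Zp_units"
  shows "continuous_on Zp_units (\<lambda>y. f (x * y))"
  by (rule continuous_on_compose2[OF assms(1) continuous_on_mult_left])
    (auto simp: Zp_units_mult assms(2))

text \<open>
  For a unit \<open>y\<close> the distance from \<open>x y\<close> to \<open>x' y\<close> is that from \<open>x\<close> to \<open>x'\<close>. Uniform continuity of \<open>f\<close>
  therefore makes the translates of \<open>f\<close> by \<open>x\<close> and \<open>x'\<close> uniformly close.
\<close>

lemma inner_integral_continuous:
  fixes f :: "'a \<Rightarrow> 'a"
  assumes D: "D \<in> Lambda_G" and f: "continuous_on Zp_units f"
  shows "continuous_on Zp_units (\<lambda>x. D (\<lambda>y. f (x * y)))"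
  unfolding continuous_on_iff
proof (intro ballI allI impI)
  fix x :: 'a and e :: real
  assume x: "x \<in> Zp_units" and e: "0 < e"
  obtain C where C: "0 \<le> C"
    "\<And>f B. continuous_on Zp_units f \<Longrightarrow> (\<And>x. x \<in> Zp_units \<Longrightarrow> absval (f x) \<le> B) \<Longrightarrow> absval (D f) \<le> C * B"
    using D by (rule measure_bound) blast
  \<comment> \<open>The constant \<open>C\<close> may be \<open>0\<close>, hence the summand \<open>1\<close>.\<close>
  define e' where "e' = e / (C + 1)"
  have e': "0 < e'" "C * e' < e"
    using C(1) e by (auto simp: e'_def field_simps)
  obtain d where d: "0 < d"
    "\<And>y y'. y \<in> Zp_units \<Longrightarrow> y' \<in> Zp_units \<Longrightarrow> dist y' y < d \<Longrightarrow> dist (f y') (f y) < e'"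
    using compact_uniformly_continuous[OF f compact_Zp_units] e'(1)
    unfolding uniformly_continuous_on_def by metis
  have "dist (D (\<lambda>y. f (x' * y))) (D (\<lambda>y. f (x * y))) < e"
    if x': "x' \<in> Zp_units" "dist x' x < d" for x'
  proof -
    have close: "absval (f (x' * y) - f (x * y)) \<le> e'" if y: "y \<in> Zp_units" for y
    proof -
      have "absval (x' * y - x * y) = absval (x' - x)"
        using absval_mult[of "x' - x" y] absval_Zp_units[OF y] by (simp add: algebra_simps)
      then have "dist (x' * y) (x * y) < d"
        using x'(2) dist_absval by metis
      then show ?thesis
        using d(2)[of "x * y" "x' * y"] x x'(1) y Zp_units_mult dist_absval
        by (metis less_imp_le)
    qed
    have "absval (D (\<lambda>y. f (x' * y) - f (x * y))) \<le> C * e'"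
      using close by (intro C(2) continuous_on_minus' translate_continuous f x x'(1))
    then have "dist (D (\<lambda>y. f (x' * y))) (D (\<lambda>y. f (x * y))) \<le> C * e'"
      by (subst dist_absval)
        (simp add: measure_diff[OF D] translate_continuous f x x'(1))
    then show ?thesis
      using e'(2) by linarith
  qed
  with d(1) show "\<exists>d>0. \<forall>x'\<in>Zp_units. dist x' x < d \<longrightarrow>
      dist (D (\<lambda>y. f (x' * y))) (D (\<lambda>y. f (x * y))) < e"
    by blast
qed

lemma mult_conv_apply:
  fixes f :: "'a \<Rightarrow> 'a"
  assumes f: "continuous_on Zp_units f"
  shows "(D1 \<star> D2) f = D1 (\<lambda>x. D2 (\<lambda>y. f (x * y)))"
proof -
  have "continuous_on (Zp_units \<times> Zp_units) (\<lambda>z. fst z * snd z :: 'a)"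
    by (intro continuous_on_times continuous_on_fst continuous_on_snd continuous_on_id)
  then have "continuous_on (Zp_units \<times> Zp_units) (\<lambda>z. f (fst z * snd z))"
    by (rule continuous_on_compose2[OF f]) (auto simp: Zp_units_mult)
  then show ?thesis
    using f by (simp add: mult_conv_def tensor_measure_def case_prod_unfold)
qed

lemma mult_conv_in_Lambda_G:
  fixes D1 D2 :: "('a \<Rightarrow> 'a) \<Rightarrow> 'a"
  assumes D1: "D1 \<in> Lambda_G" and D2: "D2 \<in> Lambda_G"
  shows "D1 \<star> D2 \<in> Lambda_G"
proof -
  obtain C1 where C1: "0 \<le> C1"
    "\<And>f B. continuous_on Zp_units f \<Longrightarrow> (\<And>x. x \<in> Zp_units \<Longrightarrow> absval (f x) \<le> B) \<Longrightarrow> absval (D1 f) \<le> C1 * B"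
    using D1 by (rule measure_bound) blast
  obtain C2 where C2: "0 \<le> C2"
    "\<And>f B. continuous_on Zp_units f \<Longrightarrow> (\<And>x. x \<in> Zp_units \<Longrightarrow> absval (f x) \<le> B) \<Longrightarrow> absval (D2 f) \<le> C2 * B"
    using D2 by (rule measure_bound) blast
  note cont = inner_integral_continuous[OF D2]
  show ?thesis
  proof (rule bounded_measuresI[where C = "C1 * C2"])
    fix f g :: "'a \<Rightarrow> 'a"
    assume f: "continuous_on Zp_units f" and g: "continuous_on Zp_units g"
    have "D1 (\<lambda>x. D2 (\<lambda>y. f (x * y) + g (x * y)))
        = D1 (\<lambda>x. D2 (\<lambda>y. f (x * y)) + D2 (\<lambda>y. g (x * y)))"
      by (rule measure_cong[OF D1]) (simp add: measure_add[OF D2] translate_continuous f g)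
    then show "(D1 \<star> D2) (\<lambda>x. f x + g x) = (D1 \<star> D2) f + (D1 \<star> D2) g"
      by (simp add: mult_conv_apply continuous_on_plus f g measure_add[OF D1] cont)
  next
    fix k and f :: "'a \<Rightarrow> 'a"
    assume f: "continuous_on Zp_units f"
    have "D1 (\<lambda>x. D2 (\<lambda>y. k * f (x * y))) = D1 (\<lambda>x. k * D2 (\<lambda>y. f (x * y)))"
      by (rule measure_cong[OF D1]) (simp add: measure_scale[OF D2] translate_continuous f)
    then show "(D1 \<star> D2) (\<lambda>x. k * f x) = k * (D1 \<star> D2) f"
      by (simp add: mult_conv_apply continuous_on_times continuous_on_const f
          measure_scale[OF D1] cont)
  next
    fix f :: "'a \<Rightarrow> 'a" and B
    assume f: "continuous_on Zp_units f" and B: "\<And>x. x \<in> Zp_units \<Longrightarrow> absval (f x) \<le> B"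
    have "absval (D1 (\<lambda>x. D2 (\<lambda>y. f (x * y)))) \<le> C1 * (C2 * B)"
      by (intro C1(2) C2(2) cont f translate_continuous B Zp_units_mult)
    then show "absval ((D1 \<star> D2) f) \<le> C1 * C2 * B"
      by (simp add: mult_conv_apply f mult.assoc)
  qed (simp add: mult_conv_def)
qed

end

section \<open>Forward differences\<close>

definition fwd_diff :: "(nat \<Rightarrow> 'b :: comm_ring_1) \<Rightarrow> nat \<Rightarrow> 'b" where
  "fwd_diff s = (\<lambda>k. s (Suc k) - s k)"

text \<open>
  With the shift \<open>E\<close>, this is the expansion of \<open>(E - 1)\<^sup>n\<close>. The sign is written \<open>(-1)\<^sup>n\<^sup>+\<^sup>i\<close> rather than
  \<open>(-1)\<^sup>n\<^sup>-\<^sup>i\<close> so that extending the sum beyond \<open>n\<close> meets no truncated subtraction.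
\<close>

lemma fwd_diff_power:
  "(fwd_diff ^^ n) s k = (\<Sum>i\<le>n. (- 1) ^ (n + i) * of_nat (n choose i) * s (k + i))"
proof (induction n arbitrary: k)
  case (Suc n)
  let ?a = "\<lambda>i. (- 1) ^ (n + i) * of_nat (n choose i)"
  have "(\<Sum>i\<le>n. ?a i * s (k + i)) = (\<Sum>i\<le>Suc n. ?a i * s (k + i))"
    by (simp add: binomial_eq_0)
  also have "\<dots> = (- 1) ^ n * s k + (\<Sum>i\<le>n. ?a (Suc i) * s (k + Suc i))"
    by (subst sum.atMost_Suc_shift) simp
  finally have shifted: "(\<Sum>i\<le>n. ?a i * s (k + i))
    = (- 1) ^ n * s k + (\<Sum>i\<le>n. ?a (Suc i) * s (k + Suc i))" .
  have "(fwd_diff ^^ Suc n) s k = (fwd_diff ^^ n) s (Suc k) - (fwd_diff ^^ n) s k"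
    by (simp add: fwd_diff_def)
  also have "\<dots> = (\<Sum>i\<le>n. ?a i * s (Suc k + i)) - (\<Sum>i\<le>n. ?a i * s (k + i))"
    by (simp add: Suc.IH)
  also have "\<dots> = - ((- 1) ^ n * s k) + (\<Sum>i\<le>n. (?a i - ?a (Suc i)) * s (k + Suc i))"
    unfolding shifted by (simp add: distrib_right sum.distrib sum_negf)
  also have "\<dots> = (- 1) ^ (Suc n + 0) * of_nat (Suc n choose 0) * s (k + 0) +
      (\<Sum>i\<le>n. (- 1) ^ (Suc n + Suc i) * of_nat (Suc n choose Suc i) * s (k + Suc i))"
    by (simp add: algebra_simps)
  also have "\<dots> = (\<Sum>i\<le>Suc n. (- 1) ^ (Suc n + i) * of_nat (Suc n choose i) * s (k + i))"
    by (subst sum.atMost_Suc_shift) (rule refl)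
  finally show ?case .
qed simp

text \<open>
  With the shift \<open>E = 1 + \<Delta>\<close>, this is the expansion of \<open>E\<^sup>k = (1 + \<Delta>)\<^sup>k\<close> at \<open>0\<close>.
\<close>

lemma newton_forward: "s k = (\<Sum>n\<le>k. of_nat (k choose n) * (fwd_diff ^^ n) s 0)"
proof (induction k arbitrary: s)
  case (Suc k)
  let ?d = "\<lambda>n. (fwd_diff ^^ n) s 0"
  have "(\<Sum>n\<le>k. of_nat (k choose n) * ?d n) = (\<Sum>n\<le>Suc k. of_nat (k choose n) * ?d n)"
    by (simp add: binomial_eq_0)
  also have "\<dots> = ?d 0 + (\<Sum>n\<le>k. of_nat (k choose Suc n) * ?d (Suc n))"
    by (subst sum.atMost_Suc_shift) simp
  finally have s: "s k = ?d 0 + (\<Sum>n\<le>k. of_nat (k choose Suc n) * ?d (Suc n))"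
    using Suc.IH[of s] by simp
  have diff: "fwd_diff s k = (\<Sum>n\<le>k. of_nat (k choose n) * ?d (Suc n))"
    using Suc.IH[of "fwd_diff s"] by (simp add: funpow_Suc_right del: funpow.simps)
  have "s (Suc k) = s k + fwd_diff s k"
    by (simp add: fwd_diff_def)
  also have "\<dots> = ?d 0 + (\<Sum>n\<le>k. of_nat (Suc k choose Suc n) * ?d (Suc n))"
    unfolding s diff by (simp add: distrib_right sum.distrib add_ac del: funpow.simps)
  also have "\<dots> = (\<Sum>n\<le>Suc k. of_nat (Suc k choose n) * ?d n)"
    by (subst sum.atMost_Suc_shift) simp
  finally show ?case .
qed simp

lemma fwd_diff_power_binomial:
  "(fwd_diff ^^ n) (\<lambda>k. of_nat (k choose j)) = (\<lambda>k. if n \<le> j then of_nat (k choose (j - n)) else 0)"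
proof (induction n)
  case (Suc n)
  show ?case
  proof (cases "Suc n \<le> j")
    case True
    then obtain i where "j - n = Suc i" "j - Suc n = i"
      by (metis Suc_diff_Suc Suc_le_lessD)
    then show ?thesis
      using True Suc.IH by (auto simp: fwd_diff_def)
  next
    case False
    then show ?thesis
      using Suc.IH by (cases "n = j") (auto simp: fwd_diff_def)
  qed
qed simp

text \<open>
  By absorption \<open>p\<^sup>m\<close> divides \<open>i\<close> times the coefficient. Were the coefficient prime to \<open>p\<close>, then \<open>p\<^sup>m\<close>
  would divide \<open>i\<close>.
\<close>

lemma prime_dvd_prime_power_choose:
  fixes p :: nat
  assumes "prime p" and "0 < i" and "i < p ^ m"
  shows "p dvd (p ^ m choose i)"
proof (rule ccontr)
  assume "\<not> p dvd (p ^ m choose i)"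
  then have "coprime (p ^ m) (p ^ m choose i)"
    using assms(1) prime_imp_coprime by (simp add: prime_imp_coprime)
  moreover have "p ^ m dvd i * (p ^ m choose i)"
    using binomial_absorption[of "i - 1" "p ^ m"] assms(2) by simp
  ultimately have "p ^ m dvd i"
    using coprime_dvd_mult_left_iff by blast
  then show False
    using assms(2,3) dvd_imp_le by fastforce
qed

section \<open>Dilating the exponent of the binomial series\<close>

lemma fps_binomial_deriv_mult:
  fixes c :: "'b :: field_char_0"
  shows "(1 + fps_X) * fps_deriv (fps_binomial c) = fps_const c * fps_binomial c"
proof -
  have "(1 + fps_X) * fps_deriv (fps_binomial c)
      = (1 + fps_X) * inverse (1 + fps_X) * (fps_const c * fps_binomial c)"
    by (simp add: fps_binomial_deriv fps_divide_unit mult_ac)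
  also have "(1 + fps_X) * inverse (1 + fps_X :: 'b fps) = 1"
    by (rule inverse_mult_eq_1') simp
  finally show ?thesis
    by simp
qed

lemma fps_binomial_ODE:
  fixes a :: "'b :: field_char_0 fps"
  assumes "(1 + fps_X) * fps_deriv a = fps_const c * a" and "fps_nth a 0 = 1"
  shows "a = fps_binomial c"
proof -
  have "fps_nth (1 + fps_X :: 'b fps) 0 \<noteq> 0"
    by simp
  then have "(1 + fps_X :: 'b fps) \<noteq> 0"
    by (metis fps_zero_nth)
  then have "fps_deriv a = fps_const c * a / (1 + fps_X)"
    unfolding assms(1)[symmetric] by simp
  then show ?thesis
    using assms(2) fps_binomial_ODE_unique' by blast
qed

text \<open>
  Formally \<open>((1 + T)\<^sup>d)\<^sup>x = (1 + T)\<^sup>d\<^sup>x\<close>. The exponent \<open>x\<close> is an arbitrary field element, so the identity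
  is derived from the differential equation \<open>(1 + T) y' = d x y\<close>, which the left-hand side inherits by
  the chain rule.
\<close>

lemma fps_binomial_compose:
  fixes x :: "'b :: field_char_0"
  shows "fps_binomial x oo ((1 + fps_X) ^ d - 1) = fps_binomial (of_nat d * x)"
proof (rule fps_binomial_ODE)
  define g :: "'b fps" where "g = (1 + fps_X) ^ d - 1"
  have g0: "fps_nth g 0 = 0"
    by (simp add: g_def fps_power_zeroth)
  have g_binomial: "g = fps_binomial (of_nat d) - 1"
    by (simp add: g_def fps_binomial_of_nat)
  have g': "(1 + fps_X) * fps_deriv g = fps_const (of_nat d) * (1 + g)"
    using fps_binomial_deriv_mult[of "of_nat d :: 'b"] by (simp add: g_binomial)
  let ?b = "fps_binomial x"
  have "(1 + fps_X) * fps_deriv ?b = fps_const x * ?b"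
    by (rule fps_binomial_deriv_mult)
  then have "((1 + fps_X) * fps_deriv ?b) oo g = (fps_const x * ?b) oo g"
    by simp
  then have b': "(1 + g) * (fps_deriv ?b oo g) = fps_const x * (?b oo g)"
    by (simp add: fps_compose_mult_distrib[OF g0] fps_compose_add_distrib g0)
  have "(1 + fps_X) * fps_deriv (?b oo g) = ((1 + fps_X) * fps_deriv g) * (fps_deriv ?b oo g)"
    by (simp add: fps_compose_deriv[OF g0] mult_ac)
  also have "\<dots> = fps_const (of_nat d) * ((1 + g) * (fps_deriv ?b oo g))"
    unfolding g' by (simp only: mult.assoc)
  also have "\<dots> = fps_const (of_nat d * x) * (?b oo g)"
    by (simp add: b' fps_const_mult[symmetric] mult.assoc del: fps_const_mult)
  finally show "(1 + fps_X) * fps_deriv (?b oo ((1 + fps_X) ^ d - 1))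
      = fps_const (of_nat d * x) * (?b oo ((1 + fps_X) ^ d - 1))"
    by (simp add: g_def)
qed simp

section \<open>Mahler expansions and Amice transforms\<close>

context padic_field
begin

lemma absval_fwd_diff_power_le:
  fixes s :: "nat \<Rightarrow> 'a"
  assumes "\<And>k. absval (s k) \<le> B"
  shows "absval ((fwd_diff ^^ n) s k) \<le> B"
proof (induction n arbitrary: k)
  case (Suc n)
  then show ?case
    by (simp add: fwd_diff_def absval_diff_le)
qed (simp add: assms)

text \<open>
  Modulo \<open>p\<close> the operator \<open>(E - 1)\<close> to the power \<open>P = p\<^sup>m\<close> is \<open>E\<^sup>P - 1\<close>: the inner binomial
  coefficients are divisible by \<open>p\<close>, and the constant term \<open>(-1)\<^sup>P\<close> is congruent to \<open>-1\<close>, for \<open>p = 2\<close>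
  as well. The first alternative of the maximum comes from \<open>E\<^sup>P - 1\<close>, the second from the multiples
  of \<open>p\<close>.
\<close>

lemma absval_fwd_diff_prime_power_le:
  fixes s :: "nat \<Rightarrow> 'a"
  assumes osc: "\<And>k. absval (s (k + p ^ m) - s k) \<le> e" and B: "\<And>k. absval (s k) \<le> B"
  shows "absval ((fwd_diff ^^ (p ^ m)) s k) \<le> max e (B / real p)"
proof -
  define P where "P = p ^ m"
  have P: "0 < P"
    using p_pos by (simp add: P_def)
  have "0 \<le> B"
    using B[of 0] zero_le_dist order_trans by blast
  \<comment> \<open>All terms other than \<open>s (k + P) - s k\<close> are integer multiples of \<open>p\<close> times values of \<open>s\<close>.\<close>
  have p_mult: "absval (of_int n * s j) \<le> B / real p" if "int p dvd n" for n j
  proof -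
    have "absval (of_int n :: 'a) \<le> 1 / real p"
      using absval_le_if_p_power_dvd[of 1 n] that by simp
    then have "absval (of_int n :: 'a) * absval (s j) \<le> 1 / real p * B"
      using B by (intro mult_mono) auto
    then show ?thesis
      by (simp add: absval_mult)
  qed
  let ?t = "\<lambda>i. (- 1) ^ (P + i) * of_nat (P choose i) * s (k + i)"
  have "(fwd_diff ^^ P) s k = sum ?t {..P}"
    by (rule fwd_diff_power)
  also have "{..P} = insert 0 (insert P {0<..<P})"
    using P by auto
  also have "sum ?t (insert 0 (insert P {0<..<P})) = (- 1) ^ P * s k + s (k + P) + sum ?t {0<..<P}"
    using P by (simp add: power_add power_mult_distrib[symmetric])
  also have "\<dots> = (s (k + P) - s k) + (of_int ((- 1) ^ P + 1) * s k + sum ?t {0<..<P})"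
    by (simp add: algebra_simps)
  finally have eq: "(fwd_diff ^^ P) s k
    = (s (k + P) - s k) + (of_int ((- 1) ^ P + 1) * s k + sum ?t {0<..<P})" .
  have "absval (of_int ((- 1) ^ P + 1) * s k) \<le> B / real p"
  proof (rule p_mult)
    show "int p dvd (- 1) ^ P + 1"
    proof (cases "even P")
      case True
      then have "p = 2"
        using primes_dvd_imp_eq[OF two_is_prime_nat prime_p] by (simp add: P_def)
      then show ?thesis
        using True by simp
    qed simp
  qed
  moreover have "absval (sum ?t {0<..<P}) \<le> B / real p"
  proof (rule absval_sum_le)
    fix i
    assume "i \<in> {0<..<P}"
    then have "p dvd (P choose i)"
      using prime_dvd_prime_power_choose[OF prime_p] by (simp add: P_def)
    then have "int p dvd (- 1) ^ (P + i) * int (P choose i)"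
      by simp
    then have "absval (of_int ((- 1) ^ (P + i) * int (P choose i)) * s (k + i)) \<le> B / real p"
      by (rule p_mult)
    then show "absval (?t i) \<le> B / real p"
      by simp
  qed (use \<open>0 \<le> B\<close> in simp)
  ultimately have "absval (of_int ((- 1) ^ P + 1) * s k + sum ?t {0<..<P}) \<le> B / real p"
    by (rule absval_add_le)
  moreover have "absval (s (k + P) - s k) \<le> e"
    unfolding P_def by (rule osc)
  ultimately have "absval ((fwd_diff ^^ P) s k) \<le> max e (B / real p)"
    unfolding eq by (intro absval_add_le[of "s (k + P) - s k"] max.coboundedI1 max.coboundedI2)
  then show ?thesis
    by (simp add: P_def)
qed

definition mahler_coeff :: "('a \<Rightarrow> 'a) \<Rightarrow> nat \<Rightarrow> 'a" where
  "mahler_coeff f n = (fwd_diff ^^ n) (\<lambda>k. f (of_nat k)) 0"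

lemma continuous_on_Zp_bounded:
  fixes f :: "'a \<Rightarrow> 'a"
  assumes "continuous_on Zp f"
  obtains B where "\<And>x. x \<in> Zp \<Longrightarrow> absval (f x) \<le> B"
proof -
  have "bounded (f ` Zp)"
    using compact_continuous_image[OF assms compact_Zp] compact_imp_bounded by blast
  then show thesis
    using that unfolding bounded_any_center[of _ 0] by (auto simp: dist_commute)
qed

lemma continuous_on_Zp_uniform:
  fixes f :: "'a \<Rightarrow> 'a"
  assumes f: "continuous_on Zp f" and e: "0 < e"
  obtains m where "\<And>x y M. x \<in> Zp \<Longrightarrow> y \<in> Zp \<Longrightarrow> m \<le> M \<Longrightarrow> absval (x - y) \<le> 1 / real p ^ M \<Longrightarrow> absval (f x - f y) \<le> e"
proof -
  obtain d where d: "0 < d" "\<And>x y. x \<in> Zp \<Longrightarrow> y \<in> Zp \<Longrightarrow> dist y x < d \<Longrightarrow> dist (f y) (f x) < e"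
    using compact_uniformly_continuous[OF f compact_Zp] e
    unfolding uniformly_continuous_on_def by metis
  obtain m where m: "1 / real p ^ m < d"
    using p_power_less[OF d(1)] .
  show thesis
  proof (rule that)
    fix x y :: 'a and M
    assume xy: "x \<in> Zp" "y \<in> Zp" and "m \<le> M" and le: "absval (x - y) \<le> 1 / real p ^ M"
    have "1 / real p ^ M \<le> 1 / real p ^ m"
      using p_gt_1 \<open>m \<le> M\<close> by (intro divide_left_mono) (auto simp: power_increasing)
    then have "dist x y < d"
      using le m dist_absval[of x y] by linarith
    then have "dist (f x) (f y) < e"
      using d(2) xy by blast
    then show "absval (f x - f y) \<le> e"
      using dist_absval[of "f x" "f y"] by linarith
  qed
qed

text \<open>
  Uniform continuity gives \<open>P = p\<^sup>m\<close> such that a shift by \<open>P\<close> changes \<open>f\<close> by at most \<open>e\<close>. Every further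
  application of \<open>\<Delta>\<^sup>P\<close> then divides the supremum by \<open>p\<close> until it drops below \<open>e\<close>. Values are
  taken on natural numbers throughout, so this is a statement about sequences.
\<close>

lemma mahler_coeff_tendsto_0:
  fixes f :: "'a \<Rightarrow> 'a"
  assumes f: "continuous_on Zp f"
  shows "mahler_coeff f \<longlonglongrightarrow> 0"
proof (rule metric_LIMSEQ_I)
  fix e' :: real
  assume e': "0 < e'"
  define e where "e = e' / 2"
  have e: "0 < e" "e < e'"
    using e' by (auto simp: e_def)
  define s where "s = (\<lambda>k. f (of_nat k))"
  obtain B where B: "\<And>k. absval (s k) \<le> B"
    using continuous_on_Zp_bounded[OF f] of_nat_in_Zp s_def by metis
  obtain m where m: "\<And>x y. x \<in> Zp \<Longrightarrow> y \<in> Zp \<Longrightarrow> absval (x - y) \<le> 1 / real p ^ m \<Longrightarrow> absval (f x - f y) \<le> e"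
    using continuous_on_Zp_uniform[OF f e(1)] order_refl by metis
  define P where "P = p ^ m"
  have osc: "absval (s (k + P) - s k) \<le> e" for k
    unfolding s_def by (intro m of_nat_in_Zp) (simp add: P_def absval_p_power)
  have iter: "absval ((fwd_diff ^^ (j * P)) s k) \<le> max e (B / real p ^ j)" for j k
  proof (induction j arbitrary: k)
    case 0
    show ?case
      using B[of k] by simp
  next
    case (Suc j)
    let ?t = "(fwd_diff ^^ (j * P)) s"
    \<comment> \<open>Differences commute with shifts, so the bound on shifts by \<open>P\<close> persists.\<close>
    have "?t (k + P) - ?t k = (fwd_diff ^^ (j * P)) (\<lambda>k. s (k + P) - s k) k" for k
      by (simp add: fwd_diff_power sum_subtractf[symmetric] algebra_simps)
    then have "absval (?t (k + P) - ?t k) \<le> e" for k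
      using absval_fwd_diff_power_le[of "\<lambda>k. s (k + P) - s k", OF osc] by simp
    then have "absval ((fwd_diff ^^ P) ?t k) \<le> max e (max e (B / real p ^ j) / real p)"
      unfolding P_def by (intro absval_fwd_diff_prime_power_le Suc.IH[unfolded P_def])
    also have "\<dots> \<le> max e (B / real p ^ Suc j)"
    proof -
      have "e / real p \<le> e"
        using e(1) p_gt_1 by (simp add: field_simps)
      then show ?thesis
        by (auto simp: max_def divide_right_mono field_simps)
    qed
    finally show ?case
      by (simp add: funpow_add)
  qed
  have "(\<lambda>j. B * (1 / real p ^ j)) \<longlonglongrightarrow> B * 0"
    by (intro tendsto_intros p_power_tendsto_0)
  then have "\<forall>\<^sub>F j in sequentially. B * (1 / real p ^ j) < e"
    using e(1) by (intro order_tendstoD(2)[where y = "B * 0"]) auto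
  then obtain j where j: "B / real p ^ j < e"
    by (auto simp: eventually_sequentially)
  have "absval (mahler_coeff f n) < e'" if "j * P \<le> n" for n
  proof -
    have "(fwd_diff ^^ n) s = (fwd_diff ^^ (n - j * P)) ((fwd_diff ^^ (j * P)) s)"
      using that by (metis comp_apply funpow_add le_add_diff_inverse2)
    then have "absval ((fwd_diff ^^ n) s 0) \<le> max e (B / real p ^ j)"
      using absval_fwd_diff_power_le[OF iter] by simp
    then show ?thesis
      using j e(2) by (simp add: mahler_coeff_def s_def)
  qed
  then show "\<exists>N. \<forall>n\<ge>N. dist (mahler_coeff f n) 0 < e'"
    by blast
qed

text \<open>
  The natural numbers are dense in the p-adic integers.
\<close>

lemma absval_le_if_on_nat:
  fixes f :: "'a \<Rightarrow> 'a"
  assumes f: "continuous_on Zp f" and nat: "\<And>k. absval (f (of_nat k)) \<le> B" and x: "x \<in> Zp"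
  shows "absval (f x) \<le> B"
proof (rule field_le_epsilon)
  fix e :: real
  assume e: "0 < e"
  obtain m where m: "\<And>x y. x \<in> Zp \<Longrightarrow> y \<in> Zp \<Longrightarrow> absval (x - y) \<le> 1 / real p ^ m \<Longrightarrow> absval (f x - f y) \<le> e"
    using continuous_on_Zp_uniform[OF f e] order_refl by metis
  obtain k where "absval (x - of_nat k) \<le> 1 / real p ^ m"
    using Zp_approx[OF x] by blast
  then have "absval (f x - f (of_nat k)) \<le> e"
    using m x of_nat_in_Zp by blast
  then show "absval (f x) \<le> B + e"
    using nat[of k] absval_triangle[of "f x - f (of_nat k)" "f (of_nat k)"] by simp
qed

lemma absval_gbinomial_le_1: "x \<in> Zp \<Longrightarrow> absval (x gchoose n :: 'a) \<le> 1"
  by (rule absval_le_if_on_nat[OF continuous_on_gbinomial])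
    (simp_all add: binomial_gbinomial[symmetric] absval_of_nat_le_1)

text \<open>
  On a natural number \<open>k\<close> Newton's formula is a finite exact expansion, so the error of the partial sum
  is made of terms with small coefficient and integral binomial factor. By density the bound extends
  to all p-adic integers.
\<close>

lemma mahler_expansion:
  fixes f :: "'a \<Rightarrow> 'a"
  assumes f: "continuous_on Zp f" and e: "0 < e"
  obtains N where "\<And>x. x \<in> Zp \<Longrightarrow> absval (f x - (\<Sum>n<N. mahler_coeff f n * (x gchoose n))) \<le> e"
proof -
  obtain N where N: "\<And>n. N \<le> n \<Longrightarrow> absval (mahler_coeff f n) < e"
    using metric_LIMSEQ_D[OF mahler_coeff_tendsto_0[OF f] e] by blast
  have nat: "absval (f (of_nat k) - (\<Sum>n<N. mahler_coeff f n * (of_nat k gchoose n))) \<le> e" for k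
  proof -
    let ?t = "\<lambda>n. mahler_coeff f n * (of_nat k gchoose n)"
    have "f (of_nat k) = (\<Sum>n\<le>k. of_nat (k choose n) * mahler_coeff f n)"
      unfolding mahler_coeff_def by (rule newton_forward)
    also have "\<dots> = sum ?t {..k}"
      by (simp add: binomial_gbinomial mult.commute)
    also have "\<dots> = sum ?t {..<N + Suc k}"
      by (rule sum.mono_neutral_left) (auto simp: binomial_gbinomial[symmetric])
    also have "\<dots> = sum ?t {..<N} + sum ?t {N..<N + Suc k}"
      by (metis atLeast0LessThan le0 le_add1 sum.atLeastLessThan_concat)
    finally have "f (of_nat k) - sum ?t {..<N} = sum ?t {N..<N + Suc k}"
      by simp
    also have "absval \<dots> \<le> e"
    proof (rule absval_sum_le)
      fix n
      assume "n \<in> {N..<N + Suc k}"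
      then have "absval (mahler_coeff f n) \<le> e"
        using N[of n] by simp
      then have "absval ((of_nat k gchoose n) * mahler_coeff f n) \<le> e"
        by (intro absval_mult_le absval_gbinomial_le_1 of_nat_in_Zp)
      then show "absval (?t n) \<le> e"
        by (simp add: mult.commute)
    qed (use e in simp)
    finally show ?thesis .
  qed
  show thesis
  proof (rule that)
    fix x :: 'a
    assume "x \<in> Zp"
    then show "absval (f x - (\<Sum>n<N. mahler_coeff f n * (x gchoose n))) \<le> e"
      by (rule absval_le_if_on_nat[rotated 2])
        (intro continuous_on_minus' f continuous_on_sum' continuous_on_times continuous_on_const
          continuous_on_gbinomial, rule nat)
  qed
qed

lemma amice_transform_nth: "fps_nth (amice_transform D) n = D (\<lambda>x :: 'a. x gchoose n)"
  by (simp add: amice_transform_def)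

text \<open>
  The coefficients of the transform are the integrals of the binomial polynomials, whose span is dense
  by Mahler's theorem.
\<close>

lemma amice_transform_inject:
  fixes D1 D2 :: "('a \<Rightarrow> 'a) \<Rightarrow> 'a"
  assumes D1: "D1 \<in> bounded_measures Zp" and D2: "D2 \<in> bounded_measures Zp"
    and eq: "amice_transform D1 = amice_transform D2"
  shows "D1 = D2"
proof (rule measure_eqI_dense[OF D1 D2])
  fix f :: "'a \<Rightarrow> 'a" and e :: real
  assume f: "continuous_on Zp f" and e: "0 < e"
  obtain N where N: "\<And>x. x \<in> Zp \<Longrightarrow> absval (f x - (\<Sum>n<N. mahler_coeff f n * (x gchoose n))) \<le> e"
    using mahler_expansion[OF f e] by blast
  let ?g = "\<lambda>x. \<Sum>n<N. mahler_coeff f n * (x gchoose n)"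
  have "D1 ?g = D2 ?g"
    using eq by (simp add: measure_sum[OF D1] measure_sum[OF D2] continuous_on_gbinomial
        fps_eq_iff amice_transform_nth)
  moreover have "continuous_on Zp ?g"
    by (intro continuous_on_sum' continuous_on_times continuous_on_const continuous_on_gbinomial)
  ultimately show "\<exists>g. continuous_on Zp g \<and> D1 g = D2 g \<and> (\<forall>x\<in>Zp. absval (f x - g x) \<le> e)"
    using N by blast
qed

text \<open>
  The measure sends \<open>f\<close> to the sum of \<open>A\<^sub>n\<close> times the \<open>n\<close>-th Mahler coefficient of \<open>f\<close>. Mahler
  coefficients are bounded by the supremum of \<open>f\<close>, which gives integrality.
\<close>

lemma measure_with_amice_transform:
  fixes A :: "'a fps"
  assumes A: "\<And>n. absval (fps_nth A n) \<le> 1"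
  obtains D where "D \<in> bounded_measures Zp" and "integral_valued Zp D" and "amice_transform D = A"
proof -
  define L where "L N f = (\<Sum>n<N. fps_nth A n * mahler_coeff f n)" for N f
  have coeff: "mahler_coeff f n = (\<Sum>i\<le>n. (- 1) ^ (n + i) * of_nat (n choose i) * f (of_nat i))" for f n
    unfolding mahler_coeff_def by (subst fwd_diff_power) simp
  have nonneg: "0 \<le> B" if "\<And>x :: 'a. x \<in> Zp \<Longrightarrow> absval (f x) \<le> B" for B and f :: "'a \<Rightarrow> 'a"
    using that[OF of_nat_in_Zp] zero_le_dist order_trans by blast
  obtain D where D: "D \<in> bounded_measures Zp"
    and lim: "\<And>f. continuous_on Zp f \<Longrightarrow> (\<lambda>N. L N f) \<longlonglongrightarrow> D f"
    and bd: "\<And>f B. continuous_on Zp f \<Longrightarrow> (\<And>x. x \<in> Zp \<Longrightarrow> absval (f x) \<le> B) \<Longrightarrow> absval (D f) \<le> B"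
  proof (rule measure_limit[of L Zp])
    show "L N (\<lambda>x. f x + g x) = L N f + L N g" for N f g
      by (simp add: L_def coeff distrib_left sum.distrib)
    show "L N (\<lambda>x. k * f x) = k * L N f" for N k f
      by (simp add: L_def coeff sum_distrib_left mult_ac)
    show "absval (L N f) \<le> B" if "\<And>x. x \<in> Zp \<Longrightarrow> absval (f x) \<le> B" for N f B
      unfolding L_def mahler_coeff_def
      by (intro absval_sum_le absval_mult_le A absval_fwd_diff_power_le that of_nat_in_Zp
          nonneg[of f])
    show "(\<lambda>N. L (Suc N) f - L N f) \<longlonglongrightarrow> 0" if "continuous_on Zp f" for f
    proof -
      have "(\<lambda>N. absval (fps_nth A N * mahler_coeff f N)) \<longlonglongrightarrow> 0"
      proof (rule tendsto_sandwich[where f = "\<lambda>_. 0"])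
        show "(\<lambda>N. absval (mahler_coeff f N)) \<longlonglongrightarrow> 0"
          using mahler_coeff_tendsto_0[OF that] tendsto_dist_iff by blast
        show "\<forall>\<^sub>F N in sequentially. absval (fps_nth A N * mahler_coeff f N) \<le> absval (mahler_coeff f N)"
          by (intro always_eventually allI absval_mult_le A order_refl)
      qed auto
      then show ?thesis
        by (simp add: L_def tendsto_iff_absval[of _ 0])
    qed
  qed blast
  have "amice_transform D = A"
  proof (rule fps_ext)
    fix j
    have delta: "mahler_coeff (\<lambda>x. x gchoose j) n = (if n = j then 1 else 0)" for n
      by (auto simp: mahler_coeff_def binomial_gbinomial[symmetric] fwd_diff_power_binomial binomial_eq_0)
    have "L N (\<lambda>x. x gchoose j) = fps_nth A j" if "j < N" for N
      using that by (simp add: L_def delta if_distrib sum.delta cong: if_cong)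
    then have "\<forall>\<^sub>F N in sequentially. L N (\<lambda>x. x gchoose j) = fps_nth A j"
      using eventually_gt_at_top by (rule eventually_mono[rotated])
    then have "(\<lambda>N. L N (\<lambda>x. x gchoose j)) \<longlonglongrightarrow> fps_nth A j"
      by (rule tendsto_eventually)
    then show "fps_nth (amice_transform D) j = fps_nth A j"
      using lim[OF continuous_on_gbinomial] LIMSEQ_unique by (metis amice_transform_nth)
  qed
  moreover have "integral_valued Zp D"
    using bd unfolding integral_valued_def valuation_ring_def by blast
  ultimately show thesis
    using D that by blast
qed

text \<open>
  The push-forward of \<open>D\<close> along \<open>x \<mapsto> u x\<close>. The case distinction is needed for elements \<open>u\<close>, such as
  \<open>0\<close>, for which \<open>x \<mapsto> f (u x)\<close> can be continuous although \<open>f\<close> is not.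
\<close>

definition dilate :: "'a \<Rightarrow> (('a \<Rightarrow> 'a) \<Rightarrow> 'a) \<Rightarrow> ('a \<Rightarrow> 'a) \<Rightarrow> 'a" where
  "dilate u D = (\<lambda>f. if continuous_on Zp f then D (\<lambda>x. f (u * x)) else 0)"

lemma dilate_in_measures:
  assumes "D \<in> bounded_measures Zp" and "u \<in> Zp"
  shows "dilate u D \<in> bounded_measures Zp"
  unfolding dilate_def
  by (rule measure_pullback[OF assms(1) continuous_on_mult_left]) (auto simp: Zp_mult assms(2))

text \<open>
  Expanding \<open>(1 + T)\<^sup>d\<^sup>x\<close> in powers of \<open>(1 + T)\<^sup>d - 1\<close> expresses the integrand \<open>x \<mapsto> d x gchoose n\<close> as a
  finite combination of binomial polynomials in \<open>x\<close>, with the coefficients of the substitution.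
\<close>

lemma amice_transform_dilate:
  assumes D: "D \<in> bounded_measures Zp"
  shows "amice_transform (dilate (of_nat d) D) = amice_transform D oo ((1 + fps_X) ^ d - 1)"
proof (rule fps_ext)
  fix n
  let ?c = "\<lambda>i. fps_nth (((1 + fps_X) ^ d - 1 :: 'a fps) ^ i) n"
  have "(of_nat d * x gchoose n) = (\<Sum>i = 0..n. ?c i * (x gchoose i))" for x :: 'a
    using fps_binomial_compose[of x d]
    by (simp add: fps_eq_iff fps_compose_nth mult.commute)
  then have "fps_nth (amice_transform (dilate (of_nat d) D)) n = D (\<lambda>x. \<Sum>i = 0..n. ?c i * (x gchoose i))"
    by (simp add: amice_transform_nth dilate_def continuous_on_gbinomial)
  also have "\<dots> = (\<Sum>i = 0..n. ?c i * D (\<lambda>x. x gchoose i))"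
    by (rule measure_sum[OF D continuous_on_gbinomial])
  finally show "fps_nth (amice_transform (dilate (of_nat d) D)) n
      = fps_nth (amice_transform D oo ((1 + fps_X) ^ d - 1)) n"
    by (simp add: fps_compose_nth amice_transform_nth mult.commute)
qed

end

section \<open>The measures attached to roots of unity\<close>

lemma eq_1_if_coprime_powers:
  fixes z :: "'b :: monoid_mult"
  assumes "z ^ a = 1" and "z ^ b = 1" and "coprime a b"
  shows "z = 1"
proof (cases "a = 0")
  case False
  then obtain x y where "a * x = b * y + gcd a b"
    using bezout_nat by blast
  then have "z ^ (a * x) = z ^ (b * y + 1)"
    using assms(3) by simp
  then have "z ^ (a * x) = z ^ (b * y) * z"
    by (simp only: power_add power_one_right)
  then show ?thesis
    using assms(1,2) by (simp add: power_mult)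
qed (use assms in simp)

context padic_field
begin

lemma absval_root_of_unity:
  fixes z :: 'a
  assumes "z ^ n = 1" and "0 < n"
  shows "absval z = 1"
  using assms absval_power[of z n] power_eq_imp_eq_base[of "absval z" n 1] by simp

text \<open>
  The powers \<open>z\<^sup>0, \<dots>, z\<^sup>n\<^sup>-\<^sup>1\<close> add up to \<open>0\<close>, so \<open>n\<close> is the sum of the elements \<open>1 - z\<^sup>i\<close>, each a multiple of
  \<open>1 - z\<close> by an integral element. As \<open>\<bar>n\<bar> = 1\<close>, the element \<open>1 - z\<close> cannot be smaller.
\<close>

lemma absval_one_minus_root_of_unity:
  fixes z :: 'a
  assumes "z ^ n = 1" and "coprime n p" and "z \<noteq> 1"
  shows "absval (1 - z) = 1"
proof -
  have "0 < n"
    using assms(2) p_gt_1 by (cases n) auto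
  then have z: "absval z = 1"
    using absval_root_of_unity assms(1) by blast
  have "(1 - z) * (\<Sum>i<n. z ^ i) = 0"
    using assms(1) one_diff_power_eq[of z n] by simp
  then have "(of_nat n :: 'a) = (\<Sum>i<n. 1 - z ^ i)"
    using assms(3) by (simp add: sum_subtractf)
  moreover have "absval (1 - z ^ i) \<le> absval (1 - z)" for i
  proof -
    have "absval (\<Sum>j<i. z ^ j) \<le> 1"
      by (rule absval_sum_le) (simp_all add: absval_power z)
    then show ?thesis
      using absval_mult_le[of "\<Sum>j<i. z ^ j" "1 - z"]
      by (simp add: one_diff_power_eq mult.commute)
  qed
  ultimately have "absval (of_nat n :: 'a) \<le> absval (1 - z)"
    by (simp add: absval_sum_le)
  moreover have "absval (1 - z) \<le> 1"
    by (rule absval_diff_le) (simp_all add: z)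
  ultimately show ?thesis
    using absval_of_nat_coprime[OF assms(2)] by simp
qed

abbreviation Zp_ball :: "nat \<Rightarrow> nat \<Rightarrow> 'a set" where
  "Zp_ball a m \<equiv> (\<lambda>y. of_nat a + of_nat p ^ m * y) ` Zp"

lemma Zp_ball_cong:
  assumes "x \<in> Zp" and "y \<in> Zp" and "absval (x - y) \<le> 1 / real p ^ m"
  shows "x \<in> Zp_ball a m \<longleftrightarrow> y \<in> Zp_ball a m"
proof -
  have "absval (x - of_nat a) \<le> 1 / real p ^ m" if "absval (y - of_nat a) \<le> 1 / real p ^ m"
    using absval_add_le[OF assms(3) that] by simp
  moreover have "absval (y - of_nat a) \<le> 1 / real p ^ m" if "absval (x - of_nat a) \<le> 1 / real p ^ m"
    using absval_diff_le[OF that assms(3)] by simp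
  ultimately show ?thesis
    using assms(1,2) unfolding Zp_ball_eq by blast
qed

lemma of_nat_in_Zp_ball_iff:
  assumes "a < p ^ m" and "b < p ^ m"
  shows "(of_nat b :: 'a) \<in> Zp_ball a m \<longleftrightarrow> b = a"
proof
  assume "(of_nat b :: 'a) \<in> Zp_ball a m"
  then have "absval (of_int (int b - int a) :: 'a) \<le> 1 / real p ^ m"
    unfolding Zp_ball_eq by simp
  then have "int p ^ m dvd int b - int a"
    by (rule p_power_dvd_if_absval_le)
  then have "int b mod int (p ^ m) = int a mod int (p ^ m)"
    by (simp add: mod_eq_dvd_iff)
  then show "b = a"
    using assms by (simp flip: zmod_int)
qed (simp add: Zp_ball_eq of_nat_in_Zp p_pos)

lemma continuous_on_indicator_Zp_ball:
  "continuous_on Zp (indicator (Zp_ball a m) :: 'a \<Rightarrow> 'a)"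
  unfolding continuous_on_iff
proof (intro ballI allI impI)
  fix x :: 'a and e :: real
  assume x: "x \<in> Zp" and "0 < e"
  have "indicator (Zp_ball a m) y = (indicator (Zp_ball a m) x :: 'a)"
    if "y \<in> Zp" "dist y x < 1 / real p ^ m" for y
    using Zp_ball_cong[OF that(1) x] that(2) dist_absval[of y x] by (auto simp: indicator_def)
  then show "\<exists>d>0. \<forall>y\<in>Zp. dist y x < d \<longrightarrow>
      dist (indicator (Zp_ball a m) y) (indicator (Zp_ball a m) x :: 'a) < e"
    using \<open>0 < e\<close> p_pos by (intro exI[of _ "1 / real p ^ m"]) auto
qed

text \<open>
  By uniform continuity, functions that are constant on the cosets of some \<open>p\<^sup>m \<int>\<^sub>p\<close> are dense.
\<close>

lemma measure_eqI_balls: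
  fixes D1 D2 :: "('a \<Rightarrow> 'a) \<Rightarrow> 'a"
  assumes D1: "D1 \<in> bounded_measures Zp" and D2: "D2 \<in> bounded_measures Zp"
    and eq: "\<And>m a. a < p ^ m \<Longrightarrow> D1 (indicator (Zp_ball a m)) = D2 (indicator (Zp_ball a m))"
  shows "D1 = D2"
proof (rule measure_eqI_dense[OF D1 D2])
  fix f :: "'a \<Rightarrow> 'a" and e :: real
  assume f: "continuous_on Zp f" and e: "0 < e"
  obtain m where m: "\<And>x y. x \<in> Zp \<Longrightarrow> y \<in> Zp \<Longrightarrow> absval (x - y) \<le> 1 / real p ^ m \<Longrightarrow> absval (f x - f y) \<le> e"
    using continuous_on_Zp_uniform[OF f e] order_refl by metis
  let ?g = "\<lambda>x. \<Sum>a<p ^ m. f (of_nat a) * indicator (Zp_ball a m) x"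
  have "continuous_on Zp ?g"
    by (intro continuous_on_sum' continuous_on_times continuous_on_const
        continuous_on_indicator_Zp_ball)
  moreover have "D1 ?g = D2 ?g"
    unfolding measure_sum[OF D1 continuous_on_indicator_Zp_ball]
      measure_sum[OF D2 continuous_on_indicator_Zp_ball]
    by (intro sum.cong refl arg_cong2[of _ _ _ _ "(*)"] eq) simp
  moreover have "absval (f x - ?g x) \<le> e" if x: "x \<in> Zp" for x
  proof -
    obtain b where b: "b < p ^ m" "absval (x - of_nat b) \<le> 1 / real p ^ m"
      using Zp_approx[OF x] .
    have "indicator (Zp_ball a m) x = (if a = b then 1 else 0 :: 'a)" if "a < p ^ m" for a
      using Zp_ball_cong[OF x of_nat_in_Zp b(2)] of_nat_in_Zp_ball_iff[OF that b(1)]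
      by (auto simp: indicator_def)
    then have "?g x = (\<Sum>a<p ^ m. f (of_nat a) * (if a = b then 1 else 0))"
      by (intro sum.cong) auto
    also have "\<dots> = f (of_nat b)"
      using b(1) by (simp add: if_distrib cong: if_cong)
    finally show ?thesis
      using m[OF x of_nat_in_Zp b(2)] by simp
  qed
  ultimately show "\<exists>g. continuous_on Zp g \<and> D1 g = D2 g \<and> (\<forall>x\<in>Zp. absval (f x - g x) \<le> e)"
    by blast
qed

lemma sum_lessThan_p_power_Suc:
  fixes g :: "nat \<Rightarrow> 'b :: comm_monoid_add"
  shows "(\<Sum>b<p ^ Suc m. g b) = (\<Sum>a<p ^ m. \<Sum>i<p. g (a + i * p ^ m))"
proof -
  have "(\<Sum>b<p * p ^ m. g b) = (\<Sum>i<p. \<Sum>b\<in>{i * p ^ m..<i * p ^ m + p ^ m}. g b)"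
    by (rule sum.nat_group[symmetric])
  also have "\<dots> = (\<Sum>i<p. \<Sum>a<p ^ m. g (a + i * p ^ m))"
    by (subst sum.atLeastLessThan_shift_0) (simp add: atLeast0LessThan add.commute)
  also have "\<dots> = (\<Sum>a<p ^ m. \<Sum>i<p. g (a + i * p ^ m))"
    by (rule sum.swap)
  finally show ?thesis
    by simp
qed

text \<open>
  The prescribed weights are additive under refinement of cosets, by summing a geometric progression,
  and have absolute value \<open>1\<close>. Hence the Riemann sums \<open>L m f\<close> are bounded by the supremum of \<open>f\<close>, and
  passing from \<open>m\<close> to \<open>m + 1\<close> changes them by at most the oscillation of \<open>f\<close> on cosets modulo \<open>p\<^sup>m\<close>.
\<close>

lemma root_of_unity_measure_exists:
  fixes z :: 'a
  assumes z: "z ^ n = 1" and n: "coprime n p" and z1: "z \<noteq> 1"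
  obtains D where "D \<in> bounded_measures Zp"
    and "\<And>m a. a < p ^ m \<Longrightarrow> D (indicator (Zp_ball a m)) = z ^ a / (1 - z ^ (p ^ m))"
proof -
  \<comment> \<open>The weight of the coset \<open>a + p\<^sup>m \<int>\<^sub>p\<close>.\<close>
  define w where "w m a = z ^ a / (1 - z ^ (p ^ m))" for m a
  have "0 < n"
    using n p_gt_1 by (cases n) auto
  have neq1: "z ^ (p ^ m) \<noteq> 1" for m
    using eq_1_if_coprime_powers[OF z, of "p ^ m"] n z1 by auto
  have abs_den: "absval (1 - z ^ (p ^ m)) = 1" for m
  proof (rule absval_one_minus_root_of_unity[OF _ n neq1])
    show "(z ^ (p ^ m)) ^ n = 1"
      using z by (metis power_mult mult.commute power_one)
  qed
  have abs_w: "absval (w m a) = 1" for m a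
    using absval_root_of_unity[OF z \<open>0 < n\<close>] by (simp add: w_def absval_divide absval_power abs_den)
  have w_refine: "(\<Sum>i<p. w (Suc m) (a + i * p ^ m)) = w m a" for m a
  proof -
    define q where "q = z ^ (p ^ m)"
    have q: "q \<noteq> 1" "q ^ p \<noteq> 1" "z ^ (p ^ Suc m) = q ^ p"
      using neq1[of m] neq1[of "Suc m"] by (simp_all add: q_def power_mult[symmetric] mult.commute)
    have "(\<Sum>i<p. w (Suc m) (a + i * p ^ m)) = (\<Sum>i<p. z ^ a / (1 - q ^ p) * q ^ i)"
      unfolding w_def q(3)
      by (simp add: q_def power_add power_mult[symmetric] mult.commute)
    also have "\<dots> = z ^ a / (1 - q ^ p) * (\<Sum>i<p. q ^ i)"
      by (rule sum_distrib_left[symmetric])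
    also have "(\<Sum>i<p. q ^ i) = (1 - q ^ p) / (1 - q)"
      using q(1) by (simp add: one_diff_power_eq)
    also have "z ^ a / (1 - q ^ p) * ((1 - q ^ p) / (1 - q)) = w m a"
      using q(1,2) by (simp add: w_def q_def)
    finally show ?thesis .
  qed
  define L where "L m f = (\<Sum>a<p ^ m. w m a * f (of_nat a))" for m and f :: "'a \<Rightarrow> 'a"
  have diff: "L (Suc m) f - L m f = (\<Sum>a<p ^ m. \<Sum>i<p. w (Suc m) (a + i * p ^ m) *
      (f (of_nat (a + i * p ^ m)) - f (of_nat a)))" for m f
  proof -
    have "L m f = (\<Sum>a<p ^ m. \<Sum>i<p. w (Suc m) (a + i * p ^ m) * f (of_nat a))"
      by (simp only: L_def sum_distrib_right[symmetric] w_refine)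
    then show ?thesis
      unfolding L_def[of "Suc m"] sum_lessThan_p_power_Suc
      by (simp add: sum_subtractf right_diff_distrib)
  qed
  have close: "absval (of_nat (a + i * p ^ m) - of_nat a :: 'a) \<le> 1 / real p ^ m" for a i m
    using absval_le_if_p_power_dvd[of m "int i * int p ^ m"] by simp
  have nonneg: "0 \<le> B" if "\<And>x :: 'a. x \<in> Zp \<Longrightarrow> absval (f x) \<le> B" for B and f :: "'a \<Rightarrow> 'a"
    using that[OF of_nat_in_Zp] zero_le_dist order_trans by blast
  obtain D where D: "D \<in> bounded_measures Zp"
    and lim: "\<And>f. continuous_on Zp f \<Longrightarrow> (\<lambda>m. L m f) \<longlonglongrightarrow> D f"
  proof (rule measure_limit[of L Zp])
    show "L m (\<lambda>x. f x + g x) = L m f + L m g" for m f g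
      by (simp add: L_def distrib_left sum.distrib)
    show "L m (\<lambda>x. k * f x) = k * L m f" for m k f
      by (simp add: L_def sum_distrib_left mult_ac)
    show "absval (L m f) \<le> B" if "\<And>x. x \<in> Zp \<Longrightarrow> absval (f x) \<le> B" for m f B
      unfolding L_def
      by (intro absval_sum_le absval_mult_le that of_nat_in_Zp nonneg[of f]) (simp_all add: abs_w)
    show "(\<lambda>m. L (Suc m) f - L m f) \<longlonglongrightarrow> 0" if f: "continuous_on Zp f" for f
    proof (rule metric_LIMSEQ_I)
      fix e :: real
      assume e: "0 < e"
      obtain M where M: "\<And>x y m. x \<in> Zp \<Longrightarrow> y \<in> Zp \<Longrightarrow> M \<le> m \<Longrightarrow> absval (x - y) \<le> 1 / real p ^ m
          \<Longrightarrow> absval (f x - f y) \<le> e / 2"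
        using continuous_on_Zp_uniform[OF f, of "e / 2"] e by auto
      have "absval (L (Suc m) f - L m f) \<le> e / 2" if "M \<le> m" for m
        unfolding diff
        by (intro absval_sum_le absval_mult_le M[OF _ _ that] of_nat_in_Zp close)
          (use e in \<open>simp_all add: abs_w\<close>)
      then show "\<exists>M. \<forall>m\<ge>M. dist (L (Suc m) f - L m f) 0 < e"
        using e by (intro exI[of _ M]) fastforce
    qed
  qed blast
  have "D (indicator (Zp_ball a m)) = w m a" if a: "a < p ^ m" for m a
  proof -
    let ?f = "indicator (Zp_ball a m) :: 'a \<Rightarrow> 'a"
    \<comment> \<open>Beyond level \<open>m\<close> refining the cosets no longer changes the Riemann sum of an indicator.\<close>
    have "L M ?f = w m a" if "m \<le> M" for M
      using that
    proof (induction M rule: dec_induct)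
      case base
      have "L m ?f = (\<Sum>b<p ^ m. w m b * (if b = a then 1 else 0))"
        unfolding L_def
        by (intro sum.cong) (auto simp: indicator_def of_nat_in_Zp_ball_iff[OF a])
      also have "\<dots> = w m a"
        using a by (simp add: if_distrib cong: if_cong)
      finally show ?case .
    next
      case (step M)
      have "1 / real p ^ M \<le> 1 / real p ^ m"
        using p_gt_1 step.hyps by (intro divide_left_mono) (auto simp: power_increasing)
      then have "absval (of_nat (b + i * p ^ M) - of_nat b :: 'a) \<le> 1 / real p ^ m" for b i
        using close order_trans by blast
      then have mem: "(of_nat (b + i * p ^ M) :: 'a) \<in> Zp_ball a m \<longleftrightarrow> of_nat b \<in> Zp_ball a m" for b i
        by (intro Zp_ball_cong of_nat_in_Zp)
      have "?f (of_nat (b + i * p ^ M)) - ?f (of_nat b) = 0" for b i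
        by (simp only: indicator_def mem diff_self)
      then have "L (Suc M) ?f - L M ?f = 0"
        by (simp only: diff mult_zero_right sum.neutral_const)
      then show ?case
        using step.IH by simp
    qed
    then have "\<forall>\<^sub>F M in sequentially. L M ?f = w m a"
      using eventually_ge_at_top by (rule eventually_mono[rotated])
    then have "(\<lambda>M. L M ?f) \<longlonglongrightarrow> w m a"
      by (rule tendsto_eventually)
    then show ?thesis
      using lim[OF continuous_on_indicator_Zp_ball] LIMSEQ_unique by blast
  qed
  with D show thesis
    using that unfolding w_def by blast
qed

lemma mu_meas_in_measures:
  fixes z :: 'a
  assumes "root_of_unity z" and "z \<noteq> 1" and "coprime (root_order z) p"
  shows "mu_meas p z \<in> bounded_measures Zp"
proof -
  have "z ^ root_order z = 1"
    using assms(1) unfolding root_of_unity_def root_order_def by (metis (mono_tags, lifting) LeastI_ex)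
  then obtain D where D: "D \<in> bounded_measures Zp"
    "\<And>m a. a < p ^ m \<Longrightarrow> D (indicator (Zp_ball a m)) = z ^ a / (1 - z ^ (p ^ m))"
    using root_of_unity_measure_exists assms(2,3) by blast
  have "mu_meas p z = D"
    unfolding mu_meas_def
  proof (rule the_equality)
    show "D \<in> bounded_measures Zp \<and>
        (\<forall>m. \<forall>a<p ^ m. D (indicator (Zp_ball a m)) = z ^ a / (1 - z ^ p ^ m))"
      using D by blast
    fix D'
    assume "D' \<in> bounded_measures Zp \<and>
        (\<forall>m. \<forall>a<p ^ m. D' (indicator (Zp_ball a m)) = z ^ a / (1 - z ^ p ^ m))"
    then show "D' = D"
      using D by (intro measure_eqI_balls) auto
  qed
  then show ?thesis
    using D(1) by simp
qed

lemma nu_pres_in_Lambda_G: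
  fixes \<xi> :: "'a \<Rightarrow>\<^sub>0 'a"
  assumes "cyclotomic_presentation p \<xi>"
  shows "nu_pres p \<xi> \<in> Lambda_G"
  unfolding nu_pres_def
proof (rule measure_combination)
  fix z
  assume "z \<in> Poly_Mapping.keys \<xi>"
  then have "mu_meas p z \<in> bounded_measures Zp"
    using assms unfolding cyclotomic_presentation_def by (intro mu_meas_in_measures) auto
  then show "nu_meas p z \<in> Lambda_G"
    unfolding nu_meas_def
    by (rule measure_restrict_units[OF _ continuous_on_inverse_units])
      (simp add: absval_inverse absval_Zp_units)
qed

end

section \<open>The measures \<open>lambda_half c\<close>\<close>

text \<open>
  Multiplication by \<open>n\<close> on the formal multiplicative group.
\<close>

definition Gm_mult :: "nat \<Rightarrow> 'b :: comm_ring_1 fps" where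
  "Gm_mult n = (1 + fps_X) ^ n - 1"

lemma Gm_mult_binomial: "Gm_mult n = fps_binomial (of_nat n :: 'b :: field_char_0) - 1"
  by (simp add: Gm_mult_def fps_binomial_of_nat)

lemma Gm_mult_nth_0 [simp]: "fps_nth (Gm_mult n :: 'b :: field_char_0 fps) 0 = 0"
  by (simp add: Gm_mult_binomial)

lemma Gm_mult_nonzero: "0 < n \<Longrightarrow> Gm_mult n \<noteq> (0 :: 'b :: field_char_0 fps)"
proof
  assume "0 < n" "Gm_mult n = (0 :: 'b fps)"
  then have "fps_nth (Gm_mult n :: 'b fps) 1 = 0"
    by simp
  then show False
    using \<open>0 < n\<close> by (simp add: Gm_mult_binomial)
qed

lemma binomial_compose_Gm_mult:
  "fps_binomial x oo Gm_mult d = fps_binomial (of_nat d * x :: 'b :: field_char_0)"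
  by (simp add: Gm_mult_def fps_binomial_compose)

lemma Gm_mult_compose: "Gm_mult c oo Gm_mult d = (Gm_mult (d * c) :: 'b :: field_char_0 fps)"
  using binomial_compose_Gm_mult[of "of_nat c :: 'b" d]
  by (simp add: Gm_mult_binomial[of c] Gm_mult_binomial[of "d * c"] fps_compose_sub_distrib)

text \<open>
  The Laurent identity \<open>A = (1 + T)\<^sup>1\<^sup>/\<^sup>2 / T - c (1 + T)\<^sup>c\<^sup>/\<^sup>2 / ((1 + T)\<^sup>c - 1)\<close> with denominators cleared.
  In this form power series can be substituted into it.
\<close>

definition is_half_transform :: "nat \<Rightarrow> 'b :: field_char_0 fps \<Rightarrow> bool" where
  "is_half_transform c A \<longleftrightarrow> fps_X * Gm_mult c * A
     = fps_binomial (1 / 2) * Gm_mult c - of_nat c * fps_X * fps_binomial (of_nat c / 2)"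

lemma is_half_transform_iff_fls:
  assumes "0 < c"
  shows "is_half_transform c (A :: 'b :: field_char_0 fps) \<longleftrightarrow> fps_to_fls A =
      fps_to_fls (fps_binomial (1 / 2)) / fls_X
      - of_nat c * (fps_to_fls (fps_binomial (of_nat c / 2)) / ((1 + fls_X) ^ c - 1))"
    (is "_ \<longleftrightarrow> ?A = ?b / fls_X - of_nat c * (?bc / ?C)")
proof -
  have "?C = fps_to_fls (Gm_mult c)"
    by (simp add: Gm_mult_def fps_to_fls_power)
  then have C: "?C \<noteq> 0" "fps_to_fls (Gm_mult c) = ?C"
    using Gm_mult_nonzero[OF assms] by simp_all
  have "is_half_transform c A \<longleftrightarrow>
      fps_to_fls (fps_X * Gm_mult c * A)
        = fps_to_fls (fps_binomial (1 / 2) * Gm_mult c - of_nat c * fps_X * fps_binomial (of_nat c / 2))"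
    by (simp only: is_half_transform_def fps_to_fls_eq_iff)
  also have "\<dots> \<longleftrightarrow> fls_X * ?C * ?A = ?b * ?C - of_nat c * fls_X * ?bc"
    by (simp only: fls_times_fps_to_fls fps_to_fls_minus fps_to_fls_of_nat fps_X_to_fls C(2))
  also have "\<dots> \<longleftrightarrow> ?A = ?b / fls_X - of_nat c * (?bc / ?C)"
  proof -
    have clear: "x * y * a = b * y - n * x * e \<longleftrightarrow> a = b / x - n * (e / y)"
      if "x \<noteq> 0" "y \<noteq> 0" for x y a b n e :: "'b fls"
      using that by (simp add: field_simps)
    show ?thesis
      by (rule clear) (use C(1) in simp_all)
  qed
  finally show ?thesis .
qed

lemma half_transform_compose:
  assumes "is_half_transform c A"
  shows "Gm_mult d * Gm_mult (d * c) * (A oo Gm_mult d)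
    = fps_binomial (of_nat d / 2) * Gm_mult (d * c)
      - of_nat c * Gm_mult d * fps_binomial (of_nat (d * c) / 2)"
proof -
  have "(fps_X * Gm_mult c * A) oo Gm_mult d
      = (fps_binomial (1 / 2) * Gm_mult c - of_nat c * fps_X * fps_binomial (of_nat c / 2)) oo Gm_mult d"
    using assms by (simp only: is_half_transform_def)
  then show ?thesis
    by (simp add: fps_compose_mult_distrib fps_compose_sub_distrib Gm_mult_compose
        binomial_compose_Gm_mult flip: fps_of_nat)
qed

text \<open>
  With \<open>B = (1 + T)\<^sup>1\<^sup>/\<^sup>2 / T\<close> and \<open>B\<^sub>n\<close> its composite with multiplication by \<open>n\<close>, both sides are
  \<open>B - c B\<^sub>c - d B\<^sub>d + c d B\<^sub>c\<^sub>d\<close>. The computation multiplies this through by the common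
  denominator \<open>T [c] [d] [c d]\<close>, where \<open>[n] = (1 + T)\<^sup>n - 1\<close>.
\<close>

lemma half_transform_symmetry:
  fixes A B :: "'b :: field_char_0 fps"
  assumes A: "is_half_transform c A" and B: "is_half_transform d B" and "0 < c" and "0 < d"
  shows "A - of_nat d * (A oo Gm_mult d) = B - of_nat c * (B oo Gm_mult c)"
proof -
  let ?C = "Gm_mult c :: 'b fps" and ?D = "Gm_mult d :: 'b fps" and ?E = "Gm_mult (c * d) :: 'b fps"
  let ?A' = "A oo ?D" and ?B' = "B oo ?C" and ?e = "fps_binomial (of_nat (c * d) / 2 :: 'b)"
  let ?b = "fps_binomial (1 / 2 :: 'b)"
  let ?bc = "fps_binomial (of_nat c / 2 :: 'b)" and ?bd = "fps_binomial (of_nat d / 2 :: 'b)"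
  have A1: "fps_X * ?C * A = ?b * ?C - of_nat c * fps_X * ?bc"
    and B1: "fps_X * ?D * B = ?b * ?D - of_nat d * fps_X * ?bd"
    using A B by (simp_all only: is_half_transform_def)
  have A2: "?D * ?E * ?A' = ?bd * ?E - of_nat c * ?D * ?e"
    using half_transform_compose[OF A, of d] by (simp only: mult.commute[of d c])
  have B2: "?C * ?E * ?B' = ?bc * ?E - of_nat d * ?C * ?e"
    by (rule half_transform_compose[OF B])
  have "fps_X * ?C * ?D * ?E * (A - of_nat d * ?A')
      = ?D * ?E * (fps_X * ?C * A) - of_nat d * fps_X * ?C * (?D * ?E * ?A')"
    by (simp add: algebra_simps)
  also have "\<dots> = ?C * ?E * (fps_X * ?D * B) - of_nat c * fps_X * ?D * (?C * ?E * ?B')"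
    unfolding A1 A2 B1 B2 by (simp add: algebra_simps)
  also have "\<dots> = fps_X * ?C * ?D * ?E * (B - of_nat c * ?B')"
    by (simp add: algebra_simps)
  finally show ?thesis
    using assms(3,4) by (simp add: Gm_mult_nonzero)
qed

context padic_field
begin

lemma integral_fps_mult:
  fixes f g :: "'a fps"
  assumes "\<And>n. absval (fps_nth f n) \<le> 1" and "\<And>n. absval (fps_nth g n) \<le> 1"
  shows "absval (fps_nth (f * g) n) \<le> 1"
  unfolding fps_mult_nth by (intro absval_sum_le absval_mult_le assms) simp

text \<open>
  The coefficient of \<open>f\<close> in degree \<open>n\<close> is determined, up to the unit \<open>fps_nth u 0\<close>, by the product and
  by the lower coefficients of \<open>f\<close>.
\<close>

lemma integral_fps_cancel_unit:
  fixes u f :: "'a fps"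
  assumes u: "\<And>n. absval (fps_nth u n) \<le> 1" and u0: "absval (fps_nth u 0) = 1"
    and uf: "\<And>n. absval (fps_nth (u * f) n) \<le> 1"
  shows "absval (fps_nth f n) \<le> 1"
proof (induction n rule: less_induct)
  case (less n)
  have "fps_nth u 0 * fps_nth f n = fps_nth (u * f) n - (\<Sum>i = 1..n. fps_nth u i * fps_nth f (n - i))"
    unfolding fps_mult_nth by (simp add: sum.atLeast_Suc_atMost)
  moreover have "absval (\<Sum>i = 1..n. fps_nth u i * fps_nth f (n - i)) \<le> 1"
    by (intro absval_sum_le absval_mult_le u less.IH) auto
  ultimately have "absval (fps_nth u 0 * fps_nth f n) \<le> 1"
    using absval_diff_le[OF uf] by simp
  then show ?case
    by (simp add: absval_mult u0)
qed

lemma half_in_Zp: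
  assumes "odd p"
  shows "(1 / 2 :: 'a) \<in> Zp"
proof -
  have "coprime 2 p"
    using assms by simp
  then have "(2 :: 'a) \<in> Zp_units"
    using of_nat_in_Zp_units[of 2] by simp
  then obtain y :: 'a where y: "y \<in> Zp" "2 * y = 1"
    unfolding Zp_units_def by blast
  then have "1 / 2 = y"
    using nonzero_mult_div_cancel_left[of "2 :: 'a" y] by simp
  then show ?thesis
    using y(1) by (simp only:)
qed

text \<open>
  Write \<open>(1 + T)\<^sup>c - 1 = T U\<close>, so that \<open>U\<close> has constant term \<open>c\<close>, a unit. The numerator over the common
  denominator \<open>T\<^sup>2 U\<close> is \<open>T V\<close> with \<open>V = (1 + T)\<^sup>1\<^sup>/\<^sup>2 U - c (1 + T)\<^sup>c\<^sup>/\<^sup>2\<close>. The constant term \<open>c - c\<close> of \<open>V\<close>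
  vanishes, hence the double pole cancels and the quotient \<open>(V / T) / U\<close> is integral.
  The parity of \<open>p\<close> makes \<open>1 / 2\<close> a p-adic integer and the two binomial series integral.
\<close>

lemma integral_half_transform_exists:
  assumes p: "odd p" and c: "coprime c p"
  obtains A :: "'a fps" where "\<And>n. absval (fps_nth A n) \<le> 1" and "is_half_transform c A"
proof -
  define U :: "'a fps" where "U = fps_shift 1 (Gm_mult c)"
  let ?b = "fps_binomial (1 / 2 :: 'a)" and ?bc = "fps_binomial (of_nat c / 2 :: 'a)"
  have X_shift: "fps_X * fps_shift 1 f = f" if "fps_nth f 0 = 0" for f :: "'a fps"
    using that by (intro fps_ext) (auto simp: gr0_conv_Suc)
  have XU: "fps_X * U = Gm_mult c"
    unfolding U_def by (rule X_shift) simp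
  have U0: "fps_nth U 0 = of_nat c"
    by (simp add: U_def Gm_mult_binomial)
  have U: "absval (fps_nth U n) \<le> 1" for n
    by (simp add: U_def Gm_mult_binomial absval_gbinomial_le_1 of_nat_in_Zp)
  have b: "absval (fps_nth ?b n) \<le> 1" "absval (fps_nth ?bc n) \<le> 1" for n
    using half_in_Zp[OF p] Zp_mult[OF of_nat_in_Zp[of c] half_in_Zp[OF p]]
    by (simp_all add: absval_gbinomial_le_1)
  define V where "V = ?b * U - of_nat c * ?bc"
  have V0: "fps_nth V 0 = 0"
    by (simp add: V_def U0)
  have const: "absval (fps_nth (of_nat c :: 'a fps) n) \<le> 1" for n
    by (simp add: fps_of_nat[symmetric] absval_of_nat_le_1 del: fps_of_nat)
  have V: "absval (fps_nth V n) \<le> 1" for n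
    unfolding V_def fps_sub_nth by (intro absval_diff_le integral_fps_mult b U const)
  have c0: "absval (fps_nth U 0) = 1"
    using absval_of_nat_coprime[OF c] by (simp add: U0)
  define A where "A = inverse U * fps_shift 1 V"
  have "fps_nth U 0 \<noteq> 0"
    using c0 by auto
  then have UA: "U * A = fps_shift 1 V"
    by (simp add: A_def mult.assoc[symmetric] inverse_mult_eq_1')
  have "absval (fps_nth A n) \<le> 1" for n
    by (rule integral_fps_cancel_unit[OF U c0]) (simp add: UA V)
  moreover have "is_half_transform c A"
  proof -
    have "fps_X * Gm_mult c * A = fps_X * (fps_X * (U * A))"
      by (simp add: XU[symmetric] mult_ac)
    also have "\<dots> = fps_X * V"
      unfolding UA X_shift[OF V0] ..
    also have "\<dots> = ?b * (fps_X * U) - of_nat c * fps_X * ?bc"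
      by (simp add: V_def algebra_simps)
    finally show ?thesis
      by (simp add: is_half_transform_def XU)
  qed
  ultimately show thesis
    using that by blast
qed

lemma lambda_half_properties:
  assumes p: "odd p" and c: "coprime c p" and "0 < c"
  shows "lambda_half c \<in> bounded_measures (Zp :: 'a set)"
    and "is_half_transform c (amice_transform (lambda_half c :: ('a \<Rightarrow> 'a) \<Rightarrow> 'a))"
proof -
  obtain A :: "'a fps" where A: "\<And>n. absval (fps_nth A n) \<le> 1" "is_half_transform c A"
    using integral_half_transform_exists[OF p c] by blast
  obtain D where D: "D \<in> bounded_measures Zp" "integral_valued Zp D" "amice_transform D = A"
    using measure_with_amice_transform[OF A(1)] by blast
  have "lambda_half c = D"
    unfolding lambda_half_def is_half_transform_iff_fls[OF \<open>0 < c\<close>, symmetric]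
  proof (rule the_equality)
    show "D \<in> bounded_measures Zp \<and> integral_valued Zp D \<and> is_half_transform c (amice_transform D)"
      using D A(2) by simp
    fix D' :: "('a \<Rightarrow> 'a) \<Rightarrow> 'a"
    assume D': "D' \<in> bounded_measures Zp \<and> integral_valued Zp D' \<and> is_half_transform c (amice_transform D')"
    then have "fps_X * Gm_mult c * amice_transform D' = fps_X * Gm_mult c * amice_transform D"
      using A(2) D(3) by (simp add: is_half_transform_def)
    then have "amice_transform D' = amice_transform D"
      using \<open>0 < c\<close> by (simp add: Gm_mult_nonzero)
    then show "D' = D"
      using amice_transform_inject D(1) D' by blast
  qed
  then show "lambda_half c \<in> bounded_measures (Zp :: 'a set)"
    and "is_half_transform c (amice_transform (lambda_half c :: ('a \<Rightarrow> 'a) \<Rightarrow> 'a))"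
    using D A(2) by simp_all
qed

lemma lambda_half_symmetry:
  assumes p: "odd p" and c: "coprime c p" "0 < c" and d: "coprime d p" "0 < d"
    and f: "continuous_on Zp (f :: 'a \<Rightarrow> 'a)"
  shows "lambda_half c f - of_nat d * lambda_half c (\<lambda>x. f (of_nat d * x))
    = lambda_half d f - of_nat c * lambda_half d (\<lambda>x. f (of_nat c * x))"
proof -
  note C = lambda_half_properties[OF p c] and D = lambda_half_properties[OF p d]
  \<comment> \<open>\<open>R c d\<close> is the analogue of \<open>r_meas d \<star> lambda_half_units c\<close> on all p-adic integers.\<close>
  define R :: "nat \<Rightarrow> nat \<Rightarrow> ('a \<Rightarrow> 'a) \<Rightarrow> 'a"
    where "R c d = (\<lambda>f. lambda_half c f - of_nat d * dilate (of_nat d) (lambda_half c) f)" for c d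
  have R: "R c d \<in> bounded_measures Zp"
    "amice_transform (R c d) = amice_transform (lambda_half c)
       - of_nat d * (amice_transform (lambda_half c) oo Gm_mult d)"
    if "lambda_half c \<in> bounded_measures (Zp :: 'a set)" for c d
  proof -
    show "R c d \<in> bounded_measures Zp"
      unfolding R_def by (intro measure_diff_scaled dilate_in_measures that of_nat_in_Zp)
    have "amice_transform (R c d) = amice_transform (lambda_half c)
        - of_nat d * amice_transform (dilate (of_nat d) (lambda_half c))"
      by (rule fps_ext) (simp add: R_def amice_transform_nth flip: fps_of_nat)
    then show "amice_transform (R c d) = amice_transform (lambda_half c)
       - of_nat d * (amice_transform (lambda_half c) oo Gm_mult d)"
      by (simp add: amice_transform_dilate[OF that] Gm_mult_def)
  qed
  have "R c d = R d c"
  proof (rule amice_transform_inject)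
    show "amice_transform (R c d) = amice_transform (R d c)"
      unfolding R(2)[OF C(1)] R(2)[OF D(1)] by (rule half_transform_symmetry[OF C(2) D(2) c(2) d(2)])
  qed (intro R C D)+
  then have "R c d f = R d c f"
    by simp
  then show ?thesis
    using f by (simp add: R_def dilate_def)
qed

text \<open>
  For a unit \<open>d\<close>, the element \<open>d x\<close> is a unit exactly when \<open>x\<close> is, so extension by zero commutes with
  dilation.
\<close>

lemma lambda_half_units_symmetry:
  assumes p: "odd p" and c: "coprime c p" "0 < c" and d: "coprime d p" "0 < d"
    and f: "continuous_on Zp_units (f :: 'a \<Rightarrow> 'a)"
  shows "lambda_half_units c f - of_nat d * lambda_half_units c (\<lambda>x. f (of_nat d * x))
    = lambda_half_units d f - of_nat c * lambda_half_units d (\<lambda>x. f (of_nat c * x))"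
proof -
  define F where "F = (\<lambda>x. if x \<in> Zp_units then f x else 0)"
  have F: "continuous_on Zp F"
    unfolding F_def by (rule continuous_on_extend_by_zero[OF f])
  have units: "lambda_half_units c f = lambda_half c F" for c
    using f by (simp add: lambda_half_units_def restrict_units_def F_def cong: if_cong)
  have dilated: "lambda_half_units c (\<lambda>x. f (of_nat d * x)) = lambda_half c (\<lambda>x. F (of_nat d * x))"
    if "lambda_half c \<in> bounded_measures (Zp :: 'a set)" "coprime d p" for c d
  proof -
    have "lambda_half_units c (\<lambda>x. f (of_nat d * x))
        = lambda_half c (\<lambda>x. if x \<in> Zp_units then f (of_nat d * x) else 0)"
      using translate_continuous[OF f of_nat_in_Zp_units[OF that(2)]]
      by (simp add: lambda_half_units_def restrict_units_def cong: if_cong)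
    also have "\<dots> = lambda_half c (\<lambda>x. F (of_nat d * x))"
      by (rule measure_cong[OF that(1)])
        (simp add: F_def mult_unit_in_Zp_units_iff of_nat_in_Zp_units that(2))
    finally show ?thesis .
  qed
  show ?thesis
    unfolding dilated[OF lambda_half_properties(1)[OF p c] d(1)]
      dilated[OF lambda_half_properties(1)[OF p d] c(1)] units
    by (rule lambda_half_symmetry[OF p c d F])
qed

lemma lambda_half_units_in_Lambda_G:
  assumes "odd p" and "coprime c p" and "0 < c"
  shows "(lambda_half_units c :: ('a \<Rightarrow> 'a) \<Rightarrow> 'a) \<in> Lambda_G"
  unfolding lambda_half_units_def
  by (rule measure_restrict_units[OF lambda_half_properties(1)[OF assms]]) simp_all

section \<open>Symmetry of the convolution\<close>

text \<open>
  In effect \<open>r_meas d \<star> (D1 \<star> D2) = (r_meas d \<star> D1) \<star> D2\<close>, evaluated at \<open>f\<close>: the second measure occurs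
  only through the function \<open>F\<close>.
\<close>

lemma r_meas_conv_apply:
  fixes f :: "'a \<Rightarrow> 'a"
  assumes D: "D1 \<in> Lambda_G" "D2 \<in> Lambda_G" and d: "coprime d p" and f: "continuous_on Zp_units f"
  defines "F \<equiv> \<lambda>x. D2 (\<lambda>y. f (x * y))"
  shows "(r_meas d \<star> (D1 \<star> D2)) f = D1 F - of_nat d * D1 (\<lambda>x. F (of_nat d * x))"
proof -
  note u = of_nat_in_Zp_units[OF d]
  have "(r_meas d \<star> (D1 \<star> D2)) f = r_meas d (\<lambda>x. (D1 \<star> D2) (\<lambda>y. f (x * y)))"
    by (rule mult_conv_apply[OF f])
  also have "\<dots> = (D1 \<star> D2) f - of_nat d * (D1 \<star> D2) (\<lambda>y. f (of_nat d * y))"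
    using inner_integral_continuous[OF mult_conv_in_Lambda_G[OF D] f]
    by (simp add: r_meas_def dirac_def)
  also have "(D1 \<star> D2) f = D1 F"
    unfolding F_def by (rule mult_conv_apply[OF f])
  also have "(D1 \<star> D2) (\<lambda>y. f (of_nat d * y)) = D1 (\<lambda>x. F (of_nat d * x))"
    unfolding F_def by (simp add: mult_conv_apply[OF translate_continuous[OF f u]] mult.assoc)
  finally show ?thesis .
qed

end

theorem theorem4p9:
  fixes p c d :: nat
    and \<xi> :: "'a :: {field_char_0, complete_space} \<Rightarrow>\<^sub>0 'a"
  assumes "odd p"
    and "finite_ext_of_Qp p TYPE('a)"
    and "cyclotomic_presentation p \<xi>"
    and "odd c" and "c > 1" and "coprime c p"
    and "odd d" and "d > 1" and "coprime d p"
  shows "r_meas d \<star> N_meas p \<xi> c \<in> Lambda_G \<and>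
         r_meas d \<star> N_meas p \<xi> c = r_meas c \<star> N_meas p \<xi> d"
proof -
  interpret padic_field p "TYPE('a)"
    using assms(2) unfolding finite_ext_of_Qp_def by unfold_locales blast+
  have c: "coprime c p" "0 < c" and d: "coprime d p" "0 < d"
    using assms(5,6,8,9) by auto
  note nu = nu_pres_in_Lambda_G[OF assms(3)]
    and lam_c = lambda_half_units_in_Lambda_G[OF assms(1) c]
    and lam_d = lambda_half_units_in_Lambda_G[OF assms(1) d]
  have L: "r_meas d \<star> N_meas p \<xi> c \<in> Lambda_G" and R: "r_meas c \<star> N_meas p \<xi> d \<in> Lambda_G"
    unfolding N_meas_def
    by (intro mult_conv_in_Lambda_G r_meas_in_Lambda_G nu lam_c lam_d c(1) d(1))+
  have "(r_meas d \<star> N_meas p \<xi> c) f = (r_meas c \<star> N_meas p \<xi> d) f" for f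
  proof (cases "continuous_on Zp_units f")
    case True
    show ?thesis
      unfolding N_meas_def r_meas_conv_apply[OF lam_c nu d(1) True]
        r_meas_conv_apply[OF lam_d nu c(1) True]
      by (rule lambda_half_units_symmetry[OF assms(1) c d inner_integral_continuous[OF nu True]])
  next
    case False
    then show ?thesis
      using L R by (simp add: measure_not_continuous)
  qed
  then show ?thesis
    using L by blast
qed

end
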